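(* The stationary energy current $\bar j_s$ satisfies $$n\,\bar j_s\ \xrightarrow[n\to\infty]{}\ -\frac12\big(\gamma^{-1}+\gamma\big)(T_+-T_-)-\frac{\bar\tau_+^2}{2\gamma}.$$
   Context: Fix $\gamma>0$, $\tilde\gamma>0$, $T_->0$, $T_+>0$ and $\bar\tau_+\in\mathbb R$ (constant in time). For $n\ge1$ let $\Omega_n=\mathbb R^n\times\mathbb R^{n+1}$, with configurations $(\mathbf r,\mathbf p)=(r_1,\dots,r_n,p_0,\dots,p_n)$. Consider the diffusion on $\Omega_n$ with generator $L=n^2\big(A+\frac\gamma2S+\frac{\tilde\gamma}2\tilde S\big)$, where $$A=\sum_{x=1}^n(p_x-p_{x-1})\partial_{r_x}+\sum_{x=1}^{n-1}(r_{x+1}-r_x)\partial_{p_x}+r_1\partial_{p_0}+(\bar\tau_+-r_n)\partial_{p_n},$$ $$S=\sum_{x=0}^{n-1}\mathcal X_x\circ\mathcal X_x,\quad \mathcal X_x=p_{x+1}\partial_{p_x}-p_x\partial_{p_{x+1}},\qquad \tilde S=T_-\partial_{p_0}^2-p_0\partial_{p_0}+T_+\partial_{p_n}^2-p_n\partial_{p_n}.$$ It is known that for each $n$ this dynamics has a unique stationary probability measure $\mu_{\rm ss}$ on $\Omega_n$, and that it has finite second moments. Write $\langle F\rangle_{\rm ss}=\int_{\Omega_n}F\,\mathrm d\mu_{\rm ss}$ (the dependence on $n$ is suppressed). Energy currents: $j_{x,x+1}=-p_xr_{x+1}+\frac\gamma2(p_x^2-p_{x+1}^2)$ for $x\in\{0,\dots,n-1\}$,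 $j_{-1,0}=\frac{\tilde\gamma}2(T_--p_0^2)$, $j_{n,n+1}=-\frac{\tilde\gamma}2(T_+-p_n^2)-\bar\tau_+p_n$. The stationary current $\bar j_s$ is the common value $\bar j_s=\langle j_{x,x+1}\rangle_{\rm ss}$, which does not depend on $x\in\{-1,\dots,n\}$ (by the energy conservation law and stationarity); it depends on $n$. *)

theory Defs
  imports "HOL-Probability.Probability"
begin

datatype coord = R nat | P nat

type_synonym config = "coord \<Rightarrow> real"

definition coords :: "nat \<Rightarrow> coord set" where
  "coords n = R ` {1..n} \<union> P ` {0..n}"

(* The phase space \<Omega>_n = R^n x R^(n+1) with its Borel sets: the underlying set consists of the
   functions on coord that are "undefined" outside of coords n. *)
definition Omega :: "nat \<Rightarrow> config measure" where
  "Omega n = (\<Pi>\<^sub>M i\<in>coords n. borel)"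

definition partial :: "coord \<Rightarrow> (config \<Rightarrow> real) \<Rightarrow> config \<Rightarrow> real" where
  "partial i f \<xi> = deriv (\<lambda>t. f (\<xi>(i := t))) (\<xi> i)"

text \<open>
  \<open>C_fun n k\<close> is the set of \<open>k\<close> times continuously differentiable functions: all iterated partial
  derivatives up to order \<open>k\<close> exist and are continuous. The ambient product topology on
  \<open>coord \<Rightarrow> real\<close> induces the Euclidean topology on \<open>space (Omega n)\<close>. Values outside of
  \<open>space (Omega n)\<close> are irrelevant.
\<close>

definition C_fun :: "nat \<Rightarrow> nat \<Rightarrow> (config \<Rightarrow> real) set" where
  "C_fun n k = {f. \<forall>xs. set xs \<subseteq> coords n \<and> length xs \<le> k \<longrightarrow>
     continuous_on (space (Omega n)) (foldr partial xs f) \<and>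
     (length xs < k \<longrightarrow> (\<forall>i\<in>coords n. \<forall>\<xi>\<in>space (Omega n).
        (\<lambda>t. foldr partial xs f (\<xi>(i := t))) differentiable (at (\<xi> i))))}"

definition C_comp :: "nat \<Rightarrow> nat \<Rightarrow> (config \<Rightarrow> real) set" where
  "C_comp n k = {f \<in> C_fun n k. \<exists>B. \<forall>\<xi>\<in>space (Omega n).
     (\<exists>i\<in>coords n. \<bar>\<xi> i\<bar> > B) \<longrightarrow> f \<xi> = 0}"

definition op_A :: "real \<Rightarrow> nat \<Rightarrow> (config \<Rightarrow> real) \<Rightarrow> config \<Rightarrow> real" where
  "op_A \<tau> n f \<xi> =
     (\<Sum>x=1..n. (\<xi> (P x) - \<xi> (P (x - 1))) * partial (R x) f \<xi>)
   + (\<Sum>x=1..n - 1. (\<xi> (R (x + 1)) - \<xi> (R x)) * partial (P x) f \<xi>)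
   + \<xi> (R 1) * partial (P 0) f \<xi>
   + (\<tau> - \<xi> (R n)) * partial (P n) f \<xi>"

definition op_X :: "nat \<Rightarrow> (config \<Rightarrow> real) \<Rightarrow> config \<Rightarrow> real" where
  "op_X x f \<xi> = \<xi> (P (x + 1)) * partial (P x) f \<xi> - \<xi> (P x) * partial (P (x + 1)) f \<xi>"

definition op_S :: "nat \<Rightarrow> (config \<Rightarrow> real) \<Rightarrow> config \<Rightarrow> real" where
  "op_S n f \<xi> = (\<Sum>x<n. op_X x (op_X x f) \<xi>)"

definition op_S_bdry :: "real \<Rightarrow> real \<Rightarrow> nat \<Rightarrow> (config \<Rightarrow> real) \<Rightarrow> config \<Rightarrow> real" where
  "op_S_bdry Tm Tp n f \<xi> =
     Tm * partial (P 0) (partial (P 0) f) \<xi> - \<xi> (P 0) * partial (P 0) f \<xi>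
   + Tp * partial (P n) (partial (P n) f) \<xi> - \<xi> (P n) * partial (P n) f \<xi>"

definition generator ::
  "real \<Rightarrow> real \<Rightarrow> real \<Rightarrow> real \<Rightarrow> real \<Rightarrow> nat \<Rightarrow> (config \<Rightarrow> real) \<Rightarrow> config \<Rightarrow> real" where
  "generator \<gamma> \<gamma>b Tm Tp \<tau> n f \<xi> =
     (real n)\<^sup>2 * (op_A \<tau> n f \<xi> + \<gamma> / 2 * op_S n f \<xi> + \<gamma>b / 2 * op_S_bdry Tm Tp n f \<xi>)"

text \<open>
  A diffusion is given by its transition probabilities \<open>K t \<xi>\<close> (the law at time \<open>t \<ge> 0\<close> of the
  process started at \<open>\<xi>\<close>), a conservative Markov semigroup. Having generator \<open>L\<close> means
  \<open>(d/dt) P\<^sub>t f = P\<^sub>t (L f)\<close> pointwise for all compactly supported \<open>f\<close> of class \<open>C\<^sup>2\<close>, where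
  \<open>P\<^sub>t f \<xi>\<close> is the integral of \<open>f\<close> against \<open>K t \<xi>\<close>; at \<open>t = 0\<close> the derivative is one-sided.
\<close>

definition markov_semigroup :: "config measure \<Rightarrow> (real \<Rightarrow> config \<Rightarrow> config measure) \<Rightarrow> bool" where
  "markov_semigroup M K \<longleftrightarrow>
     (\<forall>t\<ge>0. K t \<in> M \<rightarrow>\<^sub>M prob_algebra M) \<and>
     (\<forall>\<xi>\<in>space M. K 0 \<xi> = return M \<xi>) \<and>
     (\<forall>s\<ge>0. \<forall>t\<ge>0. \<forall>\<xi>\<in>space M. K (s + t) \<xi> = bind (K s \<xi>) (K t))"

definition has_generator ::
  "nat \<Rightarrow> (real \<Rightarrow> config \<Rightarrow> config measure) \<Rightarrow> ((config \<Rightarrow> real) \<Rightarrow> config \<Rightarrow> real) \<Rightarrow> bool" where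
  "has_generator n K L \<longleftrightarrow>
     (\<forall>f\<in>C_comp n 2. \<forall>\<xi>\<in>space (Omega n). \<forall>t\<ge>0.
        ((\<lambda>s. \<integral>\<eta>. f \<eta> \<partial>K s \<xi>) has_real_derivative (\<integral>\<eta>. L f \<eta> \<partial>K t \<xi>)) (at t within {0..}))"

definition stationary ::
  "config measure \<Rightarrow> (real \<Rightarrow> config \<Rightarrow> config measure) \<Rightarrow> config measure \<Rightarrow> bool" where
  "stationary M K \<mu> \<longleftrightarrow>
     \<mu> \<in> space (prob_algebra M) \<and> (\<forall>t\<ge>0. bind \<mu> (K t) = \<mu>)"

(* current \<gamma> \<gamma>b Tm Tp \<tau> n x is j_{x,x+1} for x in {-1, ..., n} *)
definition current ::
  "real \<Rightarrow> real \<Rightarrow> real \<Rightarrow> real \<Rightarrow> real \<Rightarrow> nat \<Rightarrow> int \<Rightarrow> config \<Rightarrow> real" where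
  "current \<gamma> \<gamma>b Tm Tp \<tau> n x \<xi> =
     (if x = -1 then \<gamma>b / 2 * (Tm - (\<xi> (P 0))\<^sup>2)
      else if x = int n then - \<gamma>b / 2 * (Tp - (\<xi> (P n))\<^sup>2) - \<tau> * \<xi> (P n)
      else - \<xi> (P (nat x)) * \<xi> (R (nat x + 1))
           + \<gamma> / 2 * ((\<xi> (P (nat x)))\<^sup>2 - (\<xi> (P (nat x + 1)))\<^sup>2))"

(* The common value of the stationary averages of all currents; THE is meaningful only if they
   indeed coincide, so any statement about it has to establish this first. *)
definition stationary_current ::
  "real \<Rightarrow> real \<Rightarrow> real \<Rightarrow> real \<Rightarrow> real \<Rightarrow> nat \<Rightarrow> config measure \<Rightarrow> real" where
  "stationary_current \<gamma> \<gamma>b Tm Tp \<tau> n \<mu> =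
     (THE j. \<forall>x\<in>{-1..int n}. (\<integral>\<xi>. current \<gamma> \<gamma>b Tm Tp \<tau> n x \<xi> \<partial>\<mu>) = j)"

end

theory Submission
  imports Defs "HOL-Real_Asymp.Real_Asymp"
begin

text \<open>
  Let \<open>\<langle>\<cdot>\<rangle>\<close> denote the stationary average. Testing stationarity with polynomials of degree at most two,
  cut off by functions of the energy (which the noise \<open>S\<close> leaves invariant and on which \<open>A\<close> produces
  only the work \<open>\<tau> p\<^sub>n\<close>), gives closed linear equations for the first and second moments. All momenta have
  the same mean \<open>\<tau> / (n \<gamma> + \<gamma>b)\<close>, and summing the equations for \<open>\<langle>r\<^sub>x p\<^sub>x\<rangle>\<close> and \<open>\<langle>r\<^sub>x p\<^sub>x\<^sub>-\<^sub>1\<rangle>\<close> along the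
  chain expresses \<open>n j\<close> by \<open>\<langle>p\<^sub>0\<^sup>2\<rangle>\<close>, \<open>\<langle>p\<^sub>n\<^sup>2\<rangle>\<close>, \<open>\<tau>\<close> and the boundary covariances of \<open>(p\<^sub>0, r\<^sub>1)\<close> and
  \<open>(p\<^sub>n, r\<^sub>n)\<close>, where \<open>\<langle>p\<^sub>0\<^sup>2\<rangle>\<close> and \<open>\<langle>p\<^sub>n\<^sup>2\<rangle>\<close> differ from \<open>Tm\<close> and \<open>Tp\<close> by \<open>O(\<bar>j\<bar> + 1/n)\<close>.

  The boundary covariances are controlled by multiplying the equation for the covariance matrix by the
  covariance matrix and taking the trace: the result is a sum of squares that contains both covariances and
  is at most linear in \<open>j\<close>. Hence \<open>j = O(1/n)\<close>; with this the same inequality shows that both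
  covariances vanish in the limit, and the formula for \<open>n j\<close> converges.
\<close>

section \<open>Infinitesimal stationarity\<close>

text \<open>Stationarity makes the average of \<open>u \<xi> s\<close> over \<open>\<mu>\<close>
  independent of \<open>s\<close>, so the difference quotients at time 0 have integral zero. They
  tend pointwise to \<open>g\<close> and are bounded by \<open>B'\<close>, and dominated convergence
  carries this over to \<open>g\<close>.\<close>

lemma integral_generator_eq_0:
  fixes f g :: "config \<Rightarrow> real"
  assumes K: "markov_semigroup M K"
    and st: "stationary M K \<mu>"
    and der: "\<And>\<xi> t. \<xi> \<in> space M \<Longrightarrow> t \<ge> 0 \<Longrightarrow>
      ((\<lambda>s. \<integral>\<eta>. f \<eta> \<partial>K s \<xi>) has_real_derivative (\<integral>\<eta>. g \<eta> \<partial>K t \<xi>)) (at t within {0..})"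
    and f: "f \<in> borel_measurable M" "\<And>\<xi>. \<xi> \<in> space M \<Longrightarrow> \<bar>f \<xi>\<bar> \<le> B"
    and g: "g \<in> borel_measurable M" "\<And>\<xi>. \<xi> \<in> space M \<Longrightarrow> \<bar>g \<xi>\<bar> \<le> B'"
  shows "(\<integral>\<xi>. g \<xi> \<partial>\<mu>) = 0"
proof -
  have Kt: "K t \<in> M \<rightarrow>\<^sub>M prob_algebra M" if "t \<ge> 0" for t
    using K that by (auto simp: markov_semigroup_def)
  have Ks: "K t \<in> M \<rightarrow>\<^sub>M subprob_algebra M" if "t \<ge> 0" for t
    using measurable_prob_algebraD[OF Kt[OF that]] .
  have Kp: "prob_space (K t \<xi>)" "sets (K t \<xi>) = sets M" if "t \<ge> 0" "\<xi> \<in> space M" for t \<xi>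
    using measurable_space[OF Kt[OF that(1)] that(2)] by (auto simp: space_prob_algebra)
  have \<mu>: "prob_space \<mu>" "sets \<mu> = sets M"
    using st by (auto simp: stationary_def space_prob_algebra)
  have sp\<mu>: "space \<mu> = space M" using \<mu>(2) by (rule sets_eq_imp_space_eq)
  interpret \<mu>: prob_space \<mu> by fact
  define u where "u = (\<lambda>\<xi> s. \<integral>\<eta>. f \<eta> \<partial>K s \<xi>)"
  have meas_u: "(\<lambda>\<xi>. u \<xi> s) \<in> borel_measurable \<mu>" if "s \<ge> 0" for s
    unfolding u_def measurable_cong_sets[OF \<mu>(2) refl]
    by (rule measurable_compose[OF Ks[OF that] integral_measurable_subprob_algebra[OF f(1)]])
  have bnd: "\<bar>\<integral>\<eta>. h \<eta> \<partial>K t \<xi>\<bar> \<le> B0"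
    if h: "h \<in> borel_measurable M" "\<And>\<xi>. \<xi> \<in> space M \<Longrightarrow> \<bar>h \<xi>\<bar> \<le> B0" and t: "t \<ge> 0" "\<xi> \<in> space M"
    for h :: "_ \<Rightarrow> real" and B0 :: real and t \<xi>
  proof -
    interpret k: prob_space "K t \<xi>" using Kp t by auto
    have sp: "space (K t \<xi>) = space M" using Kp(2)[OF t] by (rule sets_eq_imp_space_eq)
    have hm: "h \<in> borel_measurable (K t \<xi>)"
      using h(1) measurable_cong_sets[OF Kp(2)[OF t] refl] by auto
    have int: "integrable (K t \<xi>) h"
      by (rule k.integrable_const_bound[where B = B0]) (use h sp hm in auto)
    have "\<bar>\<integral>\<eta>. h \<eta> \<partial>K t \<xi>\<bar> \<le> (\<integral>\<eta>. \<bar>h \<eta>\<bar> \<partial>K t \<xi>)" by (rule integral_abs_bound)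
    also have "\<dots> \<le> (\<integral>\<eta>. B0 \<partial>K t \<xi>)"
      by (rule integral_mono) (use int h sp in auto)
    finally show ?thesis by (simp add: k.prob_space)
  qed
  have u0: "u \<xi> 0 = f \<xi>" if "\<xi> \<in> space M" for \<xi>
    using K that f(1) by (auto simp: markov_semigroup_def u_def integral_return)
  \<comment> \<open>Mean value inequality in time: the derivative at time \<open>t\<close> is an
    average of \<open>g\<close>, hence at most \<open>B'\<close> in modulus. The resulting bound on
    the difference quotients is uniform in \<open>\<xi>\<close> and \<open>s\<close>.\<close>
  have lip: "\<bar>u \<xi> s - u \<xi> 0\<bar> \<le> B' * s" if s: "s > 0" and \<xi>: "\<xi> \<in> space M" for s \<xi>
  proof -
    have "norm (u \<xi> s - u \<xi> 0) \<le> B' * norm (s - 0)"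
    proof (rule field_differentiable_bound[of "{0..}" "u \<xi>" "\<lambda>t. \<integral>\<eta>. g \<eta> \<partial>K t \<xi>"])
      show "(u \<xi> has_field_derivative (\<integral>\<eta>. g \<eta> \<partial>K t \<xi>)) (at t within {0..})" if "t \<in> {0..}" for t
        using der[OF \<xi>] that by (simp add: u_def)
      show "norm (\<integral>\<eta>. g \<eta> \<partial>K t \<xi>) \<le> B'" if "t \<in> {0..}" for t
        using bnd[OF g, of t \<xi>] that \<xi> by simp
    qed (use s in auto)
    thus ?thesis using s by simp
  qed
  have inv: "(\<integral>\<xi>. u \<xi> s \<partial>\<mu>) = (\<integral>\<xi>. f \<xi> \<partial>\<mu>)" if s: "s \<ge> 0" for s
  proof -
    have "(\<integral>\<xi>. f \<xi> \<partial>\<mu>) = (\<integral>\<xi>. f \<xi> \<partial>(bind \<mu> (K s)))"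
      using st s by (simp add: stationary_def)
    also have "\<dots> = (\<integral>\<xi>. u \<xi> s \<partial>\<mu>)"
      unfolding u_def
    proof (rule integral_bind[where B' = 1 and K = M and B = B])
      show "K s \<in> measurable \<mu> (subprob_algebra M)"
        using Ks[OF s] measurable_cong_sets[OF \<mu>(2) refl] by auto
      show "AE x in \<mu>. emeasure (K s x) (space (K s x)) \<le> ennreal 1"
        using Kp[OF s] by (auto intro!: AE_I2 simp: sp\<mu> prob_space.emeasure_space_1)
    qed (use f \<mu>.finite_measure_axioms in \<open>auto\<close>)
    finally show ?thesis by simp
  qed
  \<comment> \<open>Dominated convergence works along sequences, so time 0 is approached from the
    right along \<open>1 / (k + 1)\<close>.\<close>
  define s :: "nat \<Rightarrow> real" where "s = (\<lambda>k. inverse (real (Suc k)))"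
  have s: "s k > 0" for k by (simp add: s_def)
  have s0: "s \<longlonglongrightarrow> 0" unfolding s_def by (rule LIMSEQ_inverse_real_of_nat)
  have "(\<lambda>k. \<integral>\<xi>. (u \<xi> (s k) - u \<xi> 0) / s k \<partial>\<mu>) \<longlonglongrightarrow> (\<integral>\<xi>. g \<xi> \<partial>\<mu>)"
  proof (rule integral_dominated_convergence[where w = "\<lambda>_. B'"])
    show "g \<in> borel_measurable \<mu>" using g(1) measurable_cong_sets[OF \<mu>(2) refl] by auto
    show "(\<lambda>\<xi>. (u \<xi> (s k) - u \<xi> 0) / s k) \<in> borel_measurable \<mu>" for k
      using meas_u[of "s k"] meas_u[of 0] s[of k] by auto
    show "AE \<xi> in \<mu>. (\<lambda>k. (u \<xi> (s k) - u \<xi> 0) / s k) \<longlonglongrightarrow> g \<xi>"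
    proof (rule AE_I2)
      fix \<xi> assume "\<xi> \<in> space \<mu>"
      hence \<xi>: "\<xi> \<in> space M" by (simp add: sp\<mu>)
      have "(u \<xi> has_real_derivative g \<xi>) (at 0 within {0..})"
        using der[OF \<xi>, of 0] K \<xi> g(1)
        by (auto simp: markov_semigroup_def u_def integral_return)
      hence "((\<lambda>y. (u \<xi> y - u \<xi> 0) / (y - 0)) \<longlongrightarrow> g \<xi>) (at 0 within {0..})"
        by (simp add: has_field_derivative_iff)
      moreover have "filterlim s (at 0 within {0..}) sequentially"
        unfolding filterlim_at using s s0
        by (auto intro!: always_eventually simp: less_imp_le less_imp_neq[THEN not_sym])
      ultimately show "(\<lambda>k. (u \<xi> (s k) - u \<xi> 0) / s k) \<longlonglongrightarrow> g \<xi>"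
        by (auto dest: filterlim_compose[of _ "nhds (g \<xi>)" "at 0 within {0..}" s])
    qed
    show "AE \<xi> in \<mu>. norm ((u \<xi> (s k) - u \<xi> 0) / s k) \<le> B'" for k
      using lip[OF s] s[of k] by (auto intro!: AE_I2 simp: sp\<mu> divide_le_eq)
  qed simp
  moreover have "(\<integral>\<xi>. (u \<xi> (s k) - u \<xi> 0) / s k \<partial>\<mu>) = 0" for k
  proof -
    have int: "integrable \<mu> (\<lambda>\<xi>. u \<xi> t)" if "t \<ge> 0" for t
    proof (rule \<mu>.integrable_const_bound[where B = B])
      show "AE \<xi> in \<mu>. norm (u \<xi> t) \<le> B"
        using bnd[OF f that] by (auto intro!: AE_I2 simp: sp\<mu> u_def)
    qed (use meas_u that in auto)
    show ?thesis
      using int[of "s k"] int[of 0] s[of k] inv[of "s k"] inv[of 0] by simp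
  qed
  ultimately have "(\<lambda>k::nat. 0) \<longlonglongrightarrow> (\<integral>\<xi>. g \<xi> \<partial>\<mu>)"
    by (simp only:)
  thus ?thesis by (simp add: LIMSEQ_const_iff)
qed

section \<open>Partial derivatives and energy cutoffs\<close>

text \<open>\<open>partial\<close> rests on the total function \<open>deriv\<close> and carries no
  existence statement; this relation does. It ranges over all configurations, not only those in
  \<open>space (Omega n)\<close>, and so determines \<open>partial i f\<close> as a function that
  can be differentiated again.\<close>

definition has_partial :: "coord \<Rightarrow> (config \<Rightarrow> real) \<Rightarrow> (config \<Rightarrow> real) \<Rightarrow> bool" where
  "has_partial i f f' \<longleftrightarrow> (\<forall>\<xi>. ((\<lambda>t. f (\<xi>(i := t))) has_real_derivative f' \<xi>) (at (\<xi> i)))"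

lemma has_partial_imp_partial: "has_partial i f f' \<Longrightarrow> partial i f = f'"
  by (auto simp: has_partial_def partial_def fun_eq_iff intro!: DERIV_imp_deriv)

lemma has_partial_differentiable:
  "has_partial i f f' \<Longrightarrow> (\<lambda>t. f (\<xi>(i := t))) differentiable (at (\<xi> i))"
  by (auto simp: has_partial_def real_differentiable_def)

lemma has_partial_const: "has_partial i (\<lambda>_. c) (\<lambda>_. 0)"
  by (simp add: has_partial_def)

lemma has_partial_coord: "has_partial i (\<lambda>\<xi>. \<xi> j) (\<lambda>_. if j = i then 1 else 0)"
  by (auto simp: has_partial_def)

lemma has_partial_add:
  "has_partial i f f' \<Longrightarrow> has_partial i g g' \<Longrightarrow> has_partial i (\<lambda>\<xi>. f \<xi> + g \<xi>) (\<lambda>\<xi>. f' \<xi> + g' \<xi>)"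
  by (auto simp: has_partial_def intro!: DERIV_add)

lemma has_partial_mult:
  "has_partial i f f' \<Longrightarrow> has_partial i g g' \<Longrightarrow>
    has_partial i (\<lambda>\<xi>. f \<xi> * g \<xi>) (\<lambda>\<xi>. f' \<xi> * g \<xi> + f \<xi> * g' \<xi>)"
  unfolding has_partial_def
proof
  fix \<xi>
  assume "\<forall>\<xi>. ((\<lambda>t. f (\<xi>(i := t))) has_real_derivative f' \<xi>) (at (\<xi> i))"
    "\<forall>\<xi>. ((\<lambda>t. g (\<xi>(i := t))) has_real_derivative g' \<xi>) (at (\<xi> i))"
  from DERIV_mult[OF this[THEN spec, of \<xi>]]
  show "((\<lambda>t. f (\<xi>(i := t)) * g (\<xi>(i := t))) has_real_derivative f' \<xi> * g \<xi> + f \<xi> * g' \<xi>) (at (\<xi> i))"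
    by (simp add: mult.commute)
qed

lemma has_partial_compose:
  assumes f: "has_partial i f f'" and \<phi>: "\<And>u. (\<phi> has_real_derivative \<phi>' u) (at u)"
  shows "has_partial i (\<lambda>\<xi>. \<phi> (f \<xi>)) (\<lambda>\<xi>. \<phi>' (f \<xi>) * f' \<xi>)"
  unfolding has_partial_def
proof
  fix \<xi>
  have "((\<lambda>t. f (\<xi>(i := t))) has_real_derivative f' \<xi>) (at (\<xi> i))"
    using f by (simp add: has_partial_def)
  from DERIV_chain2[OF _ this, of \<phi> "\<phi>' (f \<xi>)"] \<phi>
  show "((\<lambda>t. \<phi> (f (\<xi>(i := t)))) has_real_derivative \<phi>' (f \<xi>) * f' \<xi>) (at (\<xi> i))"
    by simp
qed

lemma has_partial_cong_deriv: "has_partial i f f' \<Longrightarrow> (\<And>\<xi>. f' \<xi> = g' \<xi>) \<Longrightarrow> has_partial i f g'"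
  by (simp add: has_partial_def)

lemma finite_coords [simp]: "finite (coords n)"
  by (simp add: coords_def)

lemma R_in_coords [simp]: "R x \<in> coords n \<longleftrightarrow> 1 \<le> x \<and> x \<le> n"
  and P_in_coords [simp]: "P x \<in> coords n \<longleftrightarrow> x \<le> n"
  by (auto simp: coords_def)

lemma sum_coords: "sum f (coords n) = (\<Sum>x=1..n. f (R x)) + (\<Sum>x\<le>n. f (P x))"
  unfolding coords_def
  by (subst sum.union_disjoint) (auto simp: sum.reindex inj_on_def atLeast0AtMost)

section \<open>The energy and truncated powers of it\<close>

definition energy :: "nat \<Rightarrow> config \<Rightarrow> real" where
  "energy n \<xi> = (\<Sum>i\<in>coords n. (\<xi> i)\<^sup>2) / 2"

lemma has_partial_energy:
  assumes i: "i \<in> coords n"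
  shows "has_partial i (energy n) (\<lambda>\<xi>. \<xi> i)"
  unfolding has_partial_def
proof
  fix \<xi> :: config
  have "energy n (\<xi>(i := t)) = t\<^sup>2 / 2 + (\<Sum>j\<in>coords n - {i}. (\<xi> j)\<^sup>2) / 2" for t
    using i by (simp add: energy_def sum.remove[of "coords n" i] add_divide_distrib)
  thus "((\<lambda>t. energy n (\<xi>(i := t))) has_real_derivative \<xi> i) (at (\<xi> i))"
    by (auto intro!: derivative_eq_intros)
qed

lemma energy_nonneg: "energy n \<xi> \<ge> 0"
  by (auto simp: energy_def intro!: sum_nonneg)

lemma coord_sq_le_energy: "i \<in> coords n \<Longrightarrow> (\<xi> i)\<^sup>2 \<le> 2 * energy n \<xi>"
  using member_le_sum[of i "coords n" "\<lambda>i. (\<xi> i)\<^sup>2"] by (simp add: energy_def)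

text \<open>Away from 0 this is the power rule or the zero function. At 0 the difference quotient is
  at most \<open>|h| ^ (k + 1)\<close>, which tends to 0.\<close>

lemma DERIV_pos_part_power:
  "((\<lambda>x::real. (max 0 x) ^ (k + 2)) has_real_derivative real (k + 2) * (max 0 x) ^ (k + 1)) (at x)"
proof -
  consider "x > 0" | "x < 0" | "x = 0" by linarith
  thus ?thesis
  proof cases
    case 1
    have ev: "eventually (\<lambda>y::real. y > 0) (nhds x)" by (rule order_tendstoD(1)[OF filterlim_ident 1])
    have "((\<lambda>x. x ^ (k + 2)) has_real_derivative real (k + 2) * x ^ (k + 1)) (at x)"
      by (rule derivative_eq_intros refl)+ simp
    also have "?this \<longleftrightarrow> ?thesis"
      using 1 by (intro DERIV_cong_ev refl eventually_mono[OF ev]) (auto simp: max_def)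
    finally show ?thesis .
  next
    case 2
    have ev: "eventually (\<lambda>y::real. y < 0) (nhds x)" by (rule order_tendstoD(2)[OF filterlim_ident 2])
    have "((\<lambda>x. 0) has_real_derivative 0) (at x)" by simp
    also have "?this \<longleftrightarrow> ?thesis"
      using 2 by (intro DERIV_cong_ev refl eventually_mono[OF ev]) (auto simp: max_def)
    finally show ?thesis .
  next
    case 3
    have "((\<lambda>h::real. (max 0 h) ^ (k + 2) / h) \<longlongrightarrow> 0) (at 0)"
    proof (rule Lim_null_comparison[where g = "\<lambda>h. \<bar>h\<bar> ^ (k + 1)"])
      have "norm (max 0 h ^ (k + 2) / h) \<le> \<bar>h\<bar> ^ (k + 1)" for h :: real
      proof (cases "h > 0")
        case False
        hence "max 0 h = 0" by simp
        hence "norm (max 0 h ^ (k + 2) / h) = 0" by (simp only:) simp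
        moreover have "0 \<le> \<bar>h\<bar> ^ (k + 1)" by (rule zero_le_power) simp
        ultimately show ?thesis by linarith
      qed auto
      thus "\<forall>\<^sub>F h in at 0. norm (max 0 h ^ (k + 2) / h) \<le> \<bar>h::real\<bar> ^ (k + 1)" by simp
      have "((\<lambda>h::real. \<bar>h\<bar> ^ (k + 1)) \<longlongrightarrow> \<bar>0\<bar> ^ (k + 1)) (at 0)" by (intro tendsto_intros)
      thus "((\<lambda>h::real. \<bar>h\<bar> ^ (k + 1)) \<longlongrightarrow> 0) (at 0)" by simp
    qed
    thus ?thesis using 3 by (simp add: DERIV_def)
  qed
qed

text \<open>A truncated power rather than a smooth bump: its derivative is again a truncated power,
  one degree lower and with an explicit factor \<open>1 / N\<close>.\<close>

definition cutoff :: "nat \<Rightarrow> nat \<Rightarrow> real \<Rightarrow> real" where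
  "cutoff k N u = (max 0 (1 - u / real N)) ^ k"

lemma DERIV_cutoff:
  "(cutoff (k + 2) N has_real_derivative (- real (k + 2) / real N * cutoff (k + 1) N u)) (at u)"
proof -
  have "((\<lambda>u. 1 - u / real N) has_real_derivative (- 1 / real N)) (at u)"
    by (auto intro!: derivative_eq_intros simp: divide_inverse)
  from DERIV_chain2[OF DERIV_pos_part_power this, of k]
  have "((\<lambda>u. (max 0 (1 - u / real N)) ^ (k + 2)) has_real_derivative
      real (k + 2) * max 0 (1 - u / real N) ^ (k + 1) * (- 1 / real N)) (at u)" .
  moreover have "real (k + 2) * max 0 (1 - u / real N) ^ (k + 1) * (- 1 / real N) =
      - real (k + 2) / real N * cutoff (k + 1) N u"
    unfolding cutoff_def by (simp only: divide_inverse mult_ac mult_minus_left mult_minus_right mult_1)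
  moreover have "cutoff (k + 2) N = (\<lambda>u. (max 0 (1 - u / real N)) ^ (k + 2))"
    by (simp add: cutoff_def fun_eq_iff)
  ultimately show ?thesis by metis
qed

lemma cutoff_nonneg: "0 \<le> cutoff k N u"
  by (simp add: cutoff_def)

lemma cutoff_le_1: "u \<ge> 0 \<Longrightarrow> cutoff k N u \<le> 1"
  by (auto simp: cutoff_def intro!: power_le_one)

lemma cutoff_eq_0: "k > 0 \<Longrightarrow> N > 0 \<Longrightarrow> u \<ge> real N \<Longrightarrow> cutoff k N u = 0"
  by (simp add: cutoff_def)

lemma cutoff_tendsto: "(\<lambda>N. cutoff k N u) \<longlonglongrightarrow> 1"
proof -
  have "(\<lambda>N. u / real N) \<longlonglongrightarrow> 0"
    by (rule lim_const_over_n)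
  from tendsto_power[OF tendsto_max[OF tendsto_const[of 0] tendsto_diff[OF tendsto_const[of 1] this]], of k]
  show ?thesis by (simp add: cutoff_def)
qed

section \<open>Product rules and the class of test functions\<close>

definition pdiff :: "nat \<Rightarrow> (config \<Rightarrow> real) \<Rightarrow> bool" where
  "pdiff n f \<longleftrightarrow> (\<forall>i\<in>coords n. has_partial i f (partial i f))"

lemma pdiffI: "(\<And>i. i \<in> coords n \<Longrightarrow> has_partial i f (f' i)) \<Longrightarrow> pdiff n f"
  unfolding pdiff_def by (metis has_partial_imp_partial)

lemma pdiffD: "pdiff n f \<Longrightarrow> i \<in> coords n \<Longrightarrow> has_partial i f (partial i f)"
  by (simp add: pdiff_def)

lemma pdiff_const: "pdiff n (\<lambda>_. c)"
  by (rule pdiffI has_partial_const)+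

lemma pdiff_coord: "pdiff n (\<lambda>\<xi>. \<xi> j)"
  by (rule pdiffI has_partial_coord)+

lemma pdiff_add: "pdiff n f \<Longrightarrow> pdiff n g \<Longrightarrow> pdiff n (\<lambda>\<xi>. f \<xi> + g \<xi>)"
  by (rule pdiffI) (rule has_partial_add[OF pdiffD pdiffD])

lemma pdiff_mult: "pdiff n f \<Longrightarrow> pdiff n g \<Longrightarrow> pdiff n (\<lambda>\<xi>. f \<xi> * g \<xi>)"
  by (rule pdiffI) (rule has_partial_mult[OF pdiffD pdiffD])

lemma pdiff_diff: "pdiff n f \<Longrightarrow> pdiff n g \<Longrightarrow> pdiff n (\<lambda>\<xi>. f \<xi> - g \<xi>)"
  using pdiff_add[OF _ pdiff_mult[OF pdiff_const[of n "-1"]]] by simp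

lemma partial_const: "partial i (\<lambda>_. c) = (\<lambda>_. 0)"
  by (rule has_partial_imp_partial[OF has_partial_const])

lemma partial_coord: "partial i (\<lambda>\<xi>. \<xi> j) = (\<lambda>_. if j = i then 1 else 0)"
  by (rule has_partial_imp_partial[OF has_partial_coord])

lemma partial_add:
  "pdiff n f \<Longrightarrow> pdiff n g \<Longrightarrow> i \<in> coords n \<Longrightarrow>
    partial i (\<lambda>\<xi>. f \<xi> + g \<xi>) = (\<lambda>\<xi>. partial i f \<xi> + partial i g \<xi>)"
  by (rule has_partial_imp_partial) (rule has_partial_add[OF pdiffD pdiffD])

lemma partial_mult:
  "pdiff n f \<Longrightarrow> pdiff n g \<Longrightarrow> i \<in> coords n \<Longrightarrow>
    partial i (\<lambda>\<xi>. f \<xi> * g \<xi>) = (\<lambda>\<xi>. partial i f \<xi> * g \<xi> + f \<xi> * partial i g \<xi>)"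
  by (rule has_partial_imp_partial) (rule has_partial_mult[OF pdiffD pdiffD])

lemma op_A_mult:
  assumes "pdiff n f" "pdiff n g" "n \<ge> 1"
  shows "op_A \<tau> n (\<lambda>\<xi>. f \<xi> * g \<xi>) \<xi> = op_A \<tau> n f \<xi> * g \<xi> + f \<xi> * op_A \<tau> n g \<xi>"
proof -
  note pm = partial_mult[OF assms(1,2)]
  have "(\<Sum>x=1..n. (\<xi> (P x) - \<xi> (P (x - 1))) * partial (R x) (\<lambda>\<xi>. f \<xi> * g \<xi>) \<xi>) =
      (\<Sum>x=1..n. (\<xi> (P x) - \<xi> (P (x - 1))) * partial (R x) f \<xi>) * g \<xi>
      + f \<xi> * (\<Sum>x=1..n. (\<xi> (P x) - \<xi> (P (x - 1))) * partial (R x) g \<xi>)"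
    by (simp add: sum_distrib_left sum_distrib_right flip: sum.distrib)
       (auto intro!: sum.cong simp: pm algebra_simps)
  moreover have "(\<Sum>x=1..n - 1. (\<xi> (R (x + 1)) - \<xi> (R x)) * partial (P x) (\<lambda>\<xi>. f \<xi> * g \<xi>) \<xi>) =
      (\<Sum>x=1..n - 1. (\<xi> (R (x + 1)) - \<xi> (R x)) * partial (P x) f \<xi>) * g \<xi>
      + f \<xi> * (\<Sum>x=1..n - 1. (\<xi> (R (x + 1)) - \<xi> (R x)) * partial (P x) g \<xi>)"
    by (simp add: sum_distrib_left sum_distrib_right flip: sum.distrib)
       (auto intro!: sum.cong simp: pm algebra_simps)
  ultimately show ?thesis
    unfolding op_A_def by (simp add: pm algebra_simps)
qed

lemma op_X_mult:
  assumes "pdiff n f" "pdiff n g" "x < n"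
  shows "op_X x (\<lambda>\<xi>. f \<xi> * g \<xi>) = (\<lambda>\<xi>. op_X x f \<xi> * g \<xi> + f \<xi> * op_X x g \<xi>)"
  using assms by (auto simp: fun_eq_iff op_X_def partial_mult[OF assms(1,2)] algebra_simps)

lemma op_X_add:
  assumes "pdiff n f" "pdiff n g" "x < n"
  shows "op_X x (\<lambda>\<xi>. f \<xi> + g \<xi>) = (\<lambda>\<xi>. op_X x f \<xi> + op_X x g \<xi>)"
  using assms by (auto simp: fun_eq_iff op_X_def partial_add[OF assms(1,2)] algebra_simps)

text \<open>\<open>op_X x\<close> is a derivation, so its square obeys the second order Leibniz
  rule. The middle term is the source of the noise covariance.\<close>

lemma op_X_op_X_mult:
  assumes f: "pdiff n f" "pdiff n (op_X x f)" and g: "pdiff n g" "pdiff n (op_X x g)" and x: "x < n"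
  shows "op_X x (op_X x (\<lambda>\<xi>. f \<xi> * g \<xi>)) \<xi> =
    op_X x (op_X x f) \<xi> * g \<xi> + 2 * (op_X x f \<xi> * op_X x g \<xi>) + f \<xi> * op_X x (op_X x g) \<xi>"
  using assms by (simp add: op_X_mult[where n = n] op_X_add[where n = n] pdiff_mult)

text \<open>Continuity is asked on the whole function space. This implies membership in
  \<open>C_fun n 2\<close>, is stable under products, and yields Borel measurability
  directly.\<close>

definition C2 :: "nat \<Rightarrow> (config \<Rightarrow> real) \<Rightarrow> bool" where
  "C2 n f \<longleftrightarrow> pdiff n f \<and> continuous_on UNIV f \<and>
     (\<forall>i\<in>coords n. pdiff n (partial i f) \<and> continuous_on UNIV (partial i f) \<and>
        (\<forall>j\<in>coords n. continuous_on UNIV (partial j (partial i f))))"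

lemma C2_pdiff: "C2 n f \<Longrightarrow> pdiff n f"
  and C2_pdiff_partial: "C2 n f \<Longrightarrow> i \<in> coords n \<Longrightarrow> pdiff n (partial i f)"
  by (auto simp: C2_def)

lemma pdiff_op_X: "C2 n f \<Longrightarrow> x < n \<Longrightarrow> pdiff n (op_X x f)"
  unfolding op_X_def [abs_def] by (intro pdiff_diff pdiff_mult pdiff_coord C2_pdiff_partial) auto

lemma continuous_on_coord: "continuous_on A (\<lambda>\<xi>::config. \<xi> i)"
  by (rule continuous_on_subset[OF continuous_on_product_coordinates]) simp

lemma C2_coord: "C2 n (\<lambda>\<xi>. \<xi> i)"
  by (auto simp: C2_def partial_coord partial_const pdiff_coord pdiff_const continuous_on_coord)

lemma C2_mult:
  assumes f: "C2 n f" and g: "C2 n g"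
  shows "C2 n (\<lambda>\<xi>. f \<xi> * g \<xi>)"
  unfolding C2_def
proof (intro conjI ballI)
  show "pdiff n (\<lambda>\<xi>. f \<xi> * g \<xi>)" using f g by (intro pdiff_mult C2_pdiff)
  show "continuous_on UNIV (\<lambda>\<xi>. f \<xi> * g \<xi>)"
    using f g by (auto simp: C2_def intro!: continuous_intros)
next
  fix i assume i: "i \<in> coords n"
  note pi = partial_mult[OF C2_pdiff[OF f] C2_pdiff[OF g] i]
  show "pdiff n (partial i (\<lambda>\<xi>. f \<xi> * g \<xi>))"
    unfolding pi using f g i by (intro pdiff_add pdiff_mult C2_pdiff C2_pdiff_partial) auto
  show "continuous_on UNIV (partial i (\<lambda>\<xi>. f \<xi> * g \<xi>))"
    unfolding pi using f g i by (auto simp: C2_def intro!: continuous_intros)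
  fix j assume j: "j \<in> coords n"
  show "continuous_on UNIV (partial j (partial i (\<lambda>\<xi>. f \<xi> * g \<xi>)))"
    unfolding pi using f g i j
    by (auto simp: C2_def partial_add[where n = n] partial_mult[where n = n] pdiff_mult
        intro!: continuous_intros)
qed

lemma C2_imp_C_fun: assumes f: "C2 n f" shows "f \<in> C_fun n 2"
  unfolding C_fun_def
proof (intro CollectI allI impI)
  fix xs :: "coord list"
  assume xs: "set xs \<subseteq> coords n \<and> length xs \<le> 2"
  have diff: "(\<lambda>t. g (\<xi>(i := t))) differentiable (at (\<xi> i))" if "pdiff n g" "i \<in> coords n" for g i \<xi>
    using has_partial_differentiable[OF pdiffD[OF that]] .
  consider "xs = []" | i where "xs = [i]" | i j where "xs = [i, j]"
    using xs by (cases xs; cases "tl xs") auto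
  thus "continuous_on (space (Omega n)) (foldr partial xs f) \<and>
     (length xs < 2 \<longrightarrow> (\<forall>i\<in>coords n. \<forall>\<xi>\<in>space (Omega n).
        (\<lambda>t. foldr partial xs f (\<xi>(i := t))) differentiable (at (\<xi> i))))"
    by cases (use f xs in \<open>auto simp: C2_def intro: continuous_on_subset diff\<close>)
qed

section \<open>The generator on energy cutoffs\<close>

text \<open>3 is the least exponent for which the truncated power is twice continuously
  differentiable: two derivatives lower it to 1, where it is still continuous.\<close>

definition weight :: "nat \<Rightarrow> nat \<Rightarrow> config \<Rightarrow> real" where
  "weight n N \<xi> = cutoff 3 N (energy n \<xi>)"

lemma has_partial_weight:
  assumes "i \<in> coords n"
  shows "has_partial i (weight n N) (\<lambda>\<xi>. - 3 / real N * cutoff 2 N (energy n \<xi>) * \<xi> i)"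
proof -
  have "(cutoff 3 N has_real_derivative (- 3 / real N * cutoff 2 N u)) (at u)" for u
    using DERIV_cutoff[of 1 N u] by (simp add: numeral_3_eq_3 numeral_2_eq_2)
  from has_partial_compose[OF has_partial_energy[OF assms] this]
  show ?thesis by (simp add: weight_def [abs_def])
qed

lemmas partial_weight = has_partial_weight[THEN has_partial_imp_partial]

lemma has_partial_partial_weight:
  assumes i: "i \<in> coords n" and j: "j \<in> coords n"
  shows "has_partial j (partial i (weight n N)) (\<lambda>\<xi>.
    6 / (real N)\<^sup>2 * cutoff 1 N (energy n \<xi>) * \<xi> j * \<xi> i
    - 3 / real N * cutoff 2 N (energy n \<xi>) * (if i = j then 1 else 0))"
proof -
  have "(cutoff 2 N has_real_derivative (- 2 / real N * cutoff 1 N u)) (at u)" for u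
    using DERIV_cutoff[of 0 N u] by (simp add: numeral_2_eq_2)
  from has_partial_mult[OF has_partial_mult[OF has_partial_const[of j "- 3 / real N"]
     has_partial_compose[OF has_partial_energy[OF j] this]] has_partial_coord[of j i]]
  show ?thesis unfolding partial_weight[OF i]
    by (rule has_partial_cong_deriv) (simp add: power2_eq_square mult_ac)
qed

lemmas partial_partial_weight = has_partial_partial_weight[THEN has_partial_imp_partial]

lemma continuous_on_energy: "continuous_on A (energy n)"
  unfolding energy_def [abs_def] by (intro continuous_intros continuous_on_coord) auto

lemma continuous_on_cutoff: "continuous_on A (\<lambda>\<xi>. cutoff k N (energy n \<xi>))"
  unfolding cutoff_def divide_inverse
  by (intro continuous_intros continuous_on_max continuous_on_energy)

lemma C2_weight: "C2 n (weight n N)"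
  unfolding C2_def
proof (intro conjI ballI)
  show "pdiff n (weight n N)" by (rule pdiffI) (rule has_partial_weight)
  show "continuous_on UNIV (weight n N)"
    unfolding weight_def [abs_def] by (rule continuous_on_cutoff)
next
  fix i assume i: "i \<in> coords n"
  show "pdiff n (partial i (weight n N))" by (rule pdiffI) (rule has_partial_partial_weight[OF i])
  show "continuous_on UNIV (partial i (weight n N))"
    unfolding partial_weight[OF i] by (intro continuous_intros continuous_on_coord continuous_on_cutoff)
  fix j assume j: "j \<in> coords n"
  show "continuous_on UNIV (partial j (partial i (weight n N)))"
    unfolding partial_partial_weight[OF i j]
    by (intro continuous_intros continuous_on_coord continuous_on_cutoff)
qed

text \<open>\<open>op_X x\<close> generates the rotations in the plane of \<open>p_x\<close> and
  \<open>p_(x+1)\<close>, which preserve the energy and hence every function of it.\<close>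

lemma op_X_weight: "x < n \<Longrightarrow> op_X x (weight n N) = (\<lambda>_. 0)"
  by (auto simp: op_X_def partial_weight fun_eq_iff)

text \<open>With elongations \<open>r\<close> and momenta \<open>p\<close>, this is conservation of
  energy: the left side is \<open>op_A\<close> applied to the energy at zero tension.\<close>

lemma sum_hop_by_parts:
  fixes p r :: "nat \<Rightarrow> real"
  shows "n \<ge> 1 \<Longrightarrow> (\<Sum>x=1..n. (p x - p (x - 1)) * r x) + (\<Sum>x=1..n - 1. (r (x + 1) - r x) * p x)
    + r 1 * p 0 - r n * p n = 0"
proof (induction n)
  case (Suc n)
  show ?case
  proof (cases "n = 0")
    case False
    then obtain k where k: "n = Suc k" by (cases n) auto
    show ?thesis using Suc.IH False unfolding k by (simp add: algebra_simps)
  qed (simp add: algebra_simps)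
qed simp

text \<open>By the chain rule only the work \<open>\<tau> * \<xi> (P n)\<close> of the tension
  survives; the rest cancels by \<open>sum_hop_by_parts\<close>.\<close>

lemma op_A_weight:
  assumes "n \<ge> 1"
  shows "op_A \<tau> n (weight n N) \<xi> = - 3 / real N * cutoff 2 N (energy n \<xi>) * (\<tau> * \<xi> (P n))"
proof -
  define c where "c = - 3 / real N * cutoff 2 N (energy n \<xi>)"
  have "op_A \<tau> n (weight n N) \<xi> =
     c * ((\<Sum>x=1..n. (\<xi> (P x) - \<xi> (P (x - 1))) * \<xi> (R x))
   + (\<Sum>x=1..n - 1. (\<xi> (R (x + 1)) - \<xi> (R x)) * \<xi> (P x))
   + \<xi> (R 1) * \<xi> (P 0)
   + (\<tau> - \<xi> (R n)) * \<xi> (P n))"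
    unfolding op_A_def distrib_left sum_distrib_left using assms
    by (intro arg_cong2[where f = "(+)"] sum.cong)
       (auto simp: partial_weight c_def)
  also have "\<dots> = c * (\<tau> * \<xi> (P n))"
    using sum_hop_by_parts[OF assms, of "\<lambda>x. \<xi> (P x)" "\<lambda>x. \<xi> (R x)"]
    by (simp add: algebra_simps)
  finally show ?thesis by (simp add: c_def)
qed

lemma op_S_bdry_mult:
  assumes f: "C2 n f" and g: "C2 n g"
  shows "op_S_bdry Tm Tp n (\<lambda>\<xi>. f \<xi> * g \<xi>) \<xi> =
    op_S_bdry Tm Tp n f \<xi> * g \<xi> + f \<xi> * op_S_bdry Tm Tp n g \<xi>
    + 2 * (Tm * partial (P 0) f \<xi> * partial (P 0) g \<xi> + Tp * partial (P n) f \<xi> * partial (P n) g \<xi>)"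
  using f g
  by (simp add: op_S_bdry_def partial_mult[where n = n] partial_add[where n = n] C2_pdiff
      C2_pdiff_partial pdiff_mult algebra_simps)

text \<open>The last summand is the carre du champ of \<open>f\<close> and \<open>g\<close>. The
  factor 2 in the second order Leibniz rules turns the coefficients \<open>\<gamma> / 2\<close> and
  \<open>\<gamma>b / 2\<close> into \<open>\<gamma>\<close> and \<open>\<gamma>b\<close>.\<close>

lemma generator_mult:
  assumes f: "C2 n f" and g: "C2 n g" and n: "n \<ge> 1"
  shows "generator \<gamma> \<gamma>b Tm Tp \<tau> n (\<lambda>\<xi>. f \<xi> * g \<xi>) \<xi> =
    generator \<gamma> \<gamma>b Tm Tp \<tau> n f \<xi> * g \<xi> + f \<xi> * generator \<gamma> \<gamma>b Tm Tp \<tau> n g \<xi>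
    + (real n)\<^sup>2 * (\<gamma> * (\<Sum>x<n. op_X x f \<xi> * op_X x g \<xi>)
      + \<gamma>b * (Tm * partial (P 0) f \<xi> * partial (P 0) g \<xi> + Tp * partial (P n) f \<xi> * partial (P n) g \<xi>))"
proof -
  have "op_S n (\<lambda>\<xi>. f \<xi> * g \<xi>) \<xi> =
      (\<Sum>x<n. op_X x (op_X x f) \<xi> * g \<xi> + 2 * (op_X x f \<xi> * op_X x g \<xi>) + f \<xi> * op_X x (op_X x g) \<xi>)"
    unfolding op_S_def
    by (intro sum.cong refl op_X_op_X_mult[where n = n] C2_pdiff pdiff_op_X f g) auto
  also have "\<dots> = op_S n f \<xi> * g \<xi> + 2 * (\<Sum>x<n. op_X x f \<xi> * op_X x g \<xi>) + f \<xi> * op_S n g \<xi>"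
    by (simp add: op_S_def sum.distrib sum_distrib_left sum_distrib_right)
  finally show ?thesis
    unfolding generator_def op_A_mult[OF C2_pdiff[OF f] C2_pdiff[OF g] n] op_S_bdry_mult[OF f g]
    by (simp add: algebra_simps)
qed

text \<open>The bulk noise does not see the cutoff. What remains stems from the work and the
  thermostats, and each term has a factor \<open>1 / N\<close> or \<open>1 / N^2\<close>.\<close>

lemma generator_weight:
  assumes n: "n \<ge> 1"
  shows "generator \<gamma> \<gamma>b Tm Tp \<tau> n (weight n N) \<xi> = (real n)\<^sup>2 * (
    - 3 / real N * cutoff 2 N (energy n \<xi>) * (\<tau> * \<xi> (P n))
    + \<gamma>b / 2 * (Tm * (6 / (real N)\<^sup>2 * cutoff 1 N (energy n \<xi>) * (\<xi> (P 0))\<^sup>2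
        - 3 / real N * cutoff 2 N (energy n \<xi>))
      + 3 / real N * cutoff 2 N (energy n \<xi>) * (\<xi> (P 0))\<^sup>2
      + Tp * (6 / (real N)\<^sup>2 * cutoff 1 N (energy n \<xi>) * (\<xi> (P n))\<^sup>2
        - 3 / real N * cutoff 2 N (energy n \<xi>))
      + 3 / real N * cutoff 2 N (energy n \<xi>) * (\<xi> (P n))\<^sup>2))"
proof -
  have "op_S n (weight n N) \<xi> = 0"
    by (simp add: op_S_def op_X_weight) (simp add: op_X_def partial_const)
  thus ?thesis
    unfolding generator_def op_A_weight[OF n] op_S_bdry_def
    by (simp add: partial_partial_weight) (simp add: partial_weight power2_eq_square algebra_simps)
qed

section \<open>Borel measurability and bounds uniform in the cutoff level\<close>

text \<open>Over a countable index type the product sigma-algebra on \<open>config\<close> is the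
  Borel sigma-algebra of the product topology.\<close>

instance coord :: countable
  by countable_datatype

text \<open>On \<open>Omega n\<close> the coordinates outside of \<open>coords n\<close> are
  constantly \<open>undefined\<close>, so the inclusion into the product over all of
  \<open>coord\<close> is measurable.\<close>

lemma continuous_on_imp_borel_Omega:
  fixes f :: "config \<Rightarrow> real"
  assumes "continuous_on UNIV f"
  shows "f \<in> borel_measurable (Omega n)"
proof -
  have "(\<lambda>\<xi>. \<xi>) \<in> Omega n \<rightarrow>\<^sub>M (\<Pi>\<^sub>M i\<in>UNIV. borel)"
  proof (rule measurable_PiM_single')
    fix i :: coord
    show "(\<lambda>\<xi>. \<xi> i) \<in> borel_measurable (Omega n)"
    proof (cases "i \<in> coords n")
      case True thus ?thesis by (simp add: Omega_def)
    next
      case False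
      have "\<xi> i = undefined" if "\<xi> \<in> space (Omega n)" for \<xi>
        using that False by (auto simp: Omega_def space_PiM PiE_def extensional_def)
      thus ?thesis by (subst measurable_cong[where g = "\<lambda>_. undefined"]) auto
    qed
  qed auto
  hence "(\<lambda>\<xi>. \<xi>) \<in> Omega n \<rightarrow>\<^sub>M (borel :: config measure)"
    using measurable_cong_sets[OF refl sets_PiM_equal_borel] by auto
  from measurable_compose[OF this borel_measurable_continuous_onI[OF assms]] show ?thesis by simp
qed

text \<open>The cutoff vanishes once the energy reaches \<open>N\<close>, so \<open>a\<close> has to
  be controlled only below that level. In this way growth in \<open>\<xi>\<close> is traded for
  powers of \<open>N\<close>.\<close>

lemma cutoff_times_bound:
  assumes "k > 0" "N > 0" and b: "energy n \<xi> < real N \<Longrightarrow> \<bar>a\<bar> \<le> B" and "0 \<le> B"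
  shows "\<bar>a * cutoff k N (energy n \<xi>)\<bar> \<le> B"
proof (cases "energy n \<xi> < real N")
  case True
  have "\<bar>a * cutoff k N (energy n \<xi>)\<bar> \<le> B * 1"
    unfolding abs_mult using b[OF True] cutoff_nonneg[of k N] cutoff_le_1[OF energy_nonneg, of k N n \<xi>] assms
    by (intro mult_mono) auto
  thus ?thesis by simp
qed (use assms cutoff_eq_0 in auto)

lemma partial_weight_bound:
  assumes i: "i \<in> coords n" and N: "N > 0"
  shows "\<bar>partial i (weight n N) \<xi>\<bar> \<le> 9"
proof -
  have "\<bar>(- 3 / real N * \<xi> i) * cutoff 2 N (energy n \<xi>)\<bar> \<le> 9"
  proof (rule cutoff_times_bound)
    \<comment> \<open>The chain \<open>2 |x| \<le> 1 + x^2 \<le> 1 + 2 N \<le> 3 N\<close> bounds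
      the coordinate, and the prefactor \<open>3 / N\<close> turns \<open>3 N\<close> into
      9.\<close>
    assume "energy n \<xi> < real N"
    with coord_sq_le_energy[OF i, of \<xi>] have "(\<xi> i)\<^sup>2 \<le> 2 * real N" by linarith
    moreover have "2 * \<bar>\<xi> i\<bar> \<le> 1 + (\<xi> i)\<^sup>2"
      using zero_le_power2[of "\<bar>\<xi> i\<bar> - 1"] by (simp add: power2_eq_square algebra_simps)
    moreover have "1 \<le> real N" using N by simp
    ultimately have "\<bar>\<xi> i\<bar> \<le> 3 * real N" by linarith
    thus "\<bar>- 3 / real N * \<xi> i\<bar> \<le> 9"
      using N by (simp add: abs_mult divide_le_eq)
  qed (use N in auto)
  thus ?thesis by (simp add: partial_weight[OF i] mult_ac)
qed

text \<open>The shift to \<open>Suc N\<close> avoids \<open>N = 0\<close>, where division by zero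
  makes the cutoff constantly 1.\<close>

lemma partial_weight_tendsto:
  assumes i: "i \<in> coords n"
  shows "(\<lambda>N. partial i (weight n (Suc N)) \<xi>) \<longlonglongrightarrow> 0"
proof -
  have "(\<lambda>N. (- 3 / real N) * cutoff 2 N (energy n \<xi>) * \<xi> i) \<longlonglongrightarrow> 0 * 1 * \<xi> i"
    by (intro tendsto_mult lim_const_over_n cutoff_tendsto tendsto_const)
  from LIMSEQ_Suc[OF this] show ?thesis by (simp add: partial_weight[OF i])
qed

text \<open>Where the cutoff is nonzero, a squared coordinate is at most \<open>2 N\<close>, which
  compensates the factors \<open>1 / N\<close>. The thermostats contribute
  \<open>12 + 3 = 15\<close> per temperature, and 6 at each end for their friction.\<close>

lemma generator_weight_bound:
  assumes n: "n \<ge> 1" and N: "N > 0"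
  shows "\<bar>generator \<gamma> \<gamma>b Tm Tp \<tau> n (weight n N) \<xi>\<bar> \<le>
    (real n)\<^sup>2 * (9 * \<bar>\<tau>\<bar> + \<bar>\<gamma>b / 2\<bar> * (15 * \<bar>Tm\<bar> + 15 * \<bar>Tp\<bar> + 12))"
proof -
  define c1 c2 where "c1 = cutoff 1 N (energy n \<xi>)" and "c2 = cutoff 2 N (energy n \<xi>)"
  have N1: "real N \<ge> 1" using N by simp
  have a1: "\<bar>3 / real N * c2\<bar> \<le> 3"
    unfolding c2_def by (rule cutoff_times_bound) (use N N1 in \<open>auto simp: divide_le_eq\<close>)
  have a2: "\<bar>3 / real N * c2 * (\<xi> (P x))\<^sup>2\<bar> \<le> 6" if "x \<le> n" for x
  proof -
    have "\<bar>(3 / real N * (\<xi> (P x))\<^sup>2) * c2\<bar> \<le> 6"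
      unfolding c2_def
    proof (rule cutoff_times_bound)
      assume "energy n \<xi> < real N"
      with coord_sq_le_energy[of "P x" n \<xi>] that have "(\<xi> (P x))\<^sup>2 \<le> 2 * real N" by simp
      thus "\<bar>3 / real N * (\<xi> (P x))\<^sup>2\<bar> \<le> 6"
        using N by (simp add: abs_mult divide_le_eq)
    qed (use N in auto)
    thus ?thesis by (simp add: mult_ac)
  qed
  have a3: "\<bar>6 / (real N)\<^sup>2 * c1 * (\<xi> (P x))\<^sup>2\<bar> \<le> 12" if "x \<le> n" for x
  proof -
    have "\<bar>(6 / (real N)\<^sup>2 * (\<xi> (P x))\<^sup>2) * c1\<bar> \<le> 12"
      unfolding c1_def
    proof (rule cutoff_times_bound)
      assume "energy n \<xi> < real N"
      with coord_sq_le_energy[of "P x" n \<xi>] that have "(\<xi> (P x))\<^sup>2 \<le> 2 * real N" by simp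
      also have "\<dots> \<le> 2 * (real N)\<^sup>2" using N1 by (simp add: power2_eq_square)
      finally show "\<bar>6 / (real N)\<^sup>2 * (\<xi> (P x))\<^sup>2\<bar> \<le> 12"
        using N by (simp add: abs_mult divide_le_eq)
    qed (use N in auto)
    thus ?thesis by (simp add: mult_ac)
  qed
  have a4: "\<bar>- 3 / real N * c2 * (\<tau> * \<xi> (P n))\<bar> \<le> 9 * \<bar>\<tau>\<bar>"
    using mult_left_mono[OF partial_weight_bound[OF _ N, of "P n" n \<xi>], of "\<bar>\<tau>\<bar>"]
    by (simp add: partial_weight c2_def abs_mult mult_ac)
  have b: "\<bar>T * (6 / (real N)\<^sup>2 * c1 * (\<xi> (P x))\<^sup>2 - 3 / real N * c2)\<bar> \<le> 15 * \<bar>T\<bar>" if "x \<le> n" for x T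
  proof -
    have "\<bar>6 / (real N)\<^sup>2 * c1 * (\<xi> (P x))\<^sup>2 - 3 / real N * c2\<bar> \<le> 15"
      using a3[OF that] a1 by linarith
    from mult_left_mono[OF this, of "\<bar>T\<bar>"] show ?thesis by (simp add: abs_mult mult.commute)
  qed
  have "\<bar>Tm * (6 / (real N)\<^sup>2 * c1 * (\<xi> (P 0))\<^sup>2 - 3 / real N * c2)
      + 3 / real N * c2 * (\<xi> (P 0))\<^sup>2
      + Tp * (6 / (real N)\<^sup>2 * c1 * (\<xi> (P n))\<^sup>2 - 3 / real N * c2)
      + 3 / real N * c2 * (\<xi> (P n))\<^sup>2\<bar> \<le> 15 * \<bar>Tm\<bar> + 15 * \<bar>Tp\<bar> + 12" (is "\<bar>?Z\<bar> \<le> ?W")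
  proof -
    have "\<bar>a + b + c + d\<bar> \<le> w + y + 6 + 6"
      if "\<bar>a\<bar> \<le> w" "\<bar>b\<bar> \<le> 6" "\<bar>c\<bar> \<le> y" "\<bar>d\<bar> \<le> 6" for a b c d w y :: real
      using that by linarith
    from this[OF b[of 0 Tm] a2[of 0] b[of n Tp] a2[of n]] show ?thesis by simp
  qed
  from mult_left_mono[OF this, of "\<bar>\<gamma>b / 2\<bar>"]
  have "\<bar>\<gamma>b / 2 * ?Z\<bar> \<le> \<bar>\<gamma>b / 2\<bar> * ?W" unfolding abs_mult by simp
  with a4 have "\<bar>- 3 / real N * c2 * (\<tau> * \<xi> (P n)) + \<gamma>b / 2 * ?Z\<bar> \<le> 9 * \<bar>\<tau>\<bar> + \<bar>\<gamma>b / 2\<bar> * ?W"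
    by linarith
  from mult_left_mono[OF this, of "(real n)\<^sup>2"] show ?thesis
    unfolding generator_weight[OF n] c1_def c2_def abs_mult by simp
qed

lemma generator_weight_tendsto:
  assumes n: "n \<ge> 1"
  shows "(\<lambda>N. generator \<gamma> \<gamma>b Tm Tp \<tau> n (weight n (Suc N)) \<xi>) \<longlonglongrightarrow> 0"
proof -
  have s: "(\<lambda>N. c / (real N)\<^sup>2) \<longlonglongrightarrow> 0" for c
    using tendsto_mult[OF lim_const_over_n[of c] lim_const_over_n[of 1]]
    by (simp add: power2_eq_square)
  have "(\<lambda>N. (real n)\<^sup>2 * (
    - 3 / real N * cutoff 2 N (energy n \<xi>) * (\<tau> * \<xi> (P n))
    + \<gamma>b / 2 * (Tm * (6 / (real N)\<^sup>2 * cutoff 1 N (energy n \<xi>) * (\<xi> (P 0))\<^sup>2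
        - 3 / real N * cutoff 2 N (energy n \<xi>))
      + 3 / real N * cutoff 2 N (energy n \<xi>) * (\<xi> (P 0))\<^sup>2
      + Tp * (6 / (real N)\<^sup>2 * cutoff 1 N (energy n \<xi>) * (\<xi> (P n))\<^sup>2
        - 3 / real N * cutoff 2 N (energy n \<xi>))
      + 3 / real N * cutoff 2 N (energy n \<xi>) * (\<xi> (P n))\<^sup>2)))
    \<longlonglongrightarrow> (real n)\<^sup>2 * (0 * 1 * (\<tau> * \<xi> (P n))
    + \<gamma>b / 2 * (Tm * (0 * 1 * (\<xi> (P 0))\<^sup>2 - 0 * 1) + 0 * 1 * (\<xi> (P 0))\<^sup>2
      + Tp * (0 * 1 * (\<xi> (P n))\<^sup>2 - 0 * 1) + 0 * 1 * (\<xi> (P n))\<^sup>2))"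
    by (intro tendsto_mult tendsto_add tendsto_diff tendsto_const lim_const_over_n cutoff_tendsto s)
  hence "(\<lambda>N. generator \<gamma> \<gamma>b Tm Tp \<tau> n (weight n N) \<xi>) \<longlonglongrightarrow> 0"
    unfolding generator_weight[OF n] by simp
  from LIMSEQ_Suc[OF this] show ?thesis .
qed

section \<open>Removal of the cutoff for test functions of quadratic growth\<close>

text \<open>The growth class in which finite second moments give integrability.\<close>

definition energy_bounded :: "nat \<Rightarrow> (config \<Rightarrow> real) \<Rightarrow> bool" where
  "energy_bounded n f \<longleftrightarrow> (\<exists>C\<ge>0. \<forall>\<xi>. \<bar>f \<xi>\<bar> \<le> C * (1 + energy n \<xi>))"

lemma C_comp_times_weight:
  assumes q: "C2 n q" and N: "N > 0"
  shows "(\<lambda>\<xi>. q \<xi> * weight n N \<xi>) \<in> C_comp n 2"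
  unfolding C_comp_def
\<comment> \<open>If a coordinate exceeds \<open>1 + 2 N\<close> in modulus, so does its square; the
  energy is at least half of that, hence at least \<open>N\<close>, and the cutoff is zero.\<close>
proof (intro CollectI conjI exI[of _ "1 + 2 * real N"] ballI impI)
  show "(\<lambda>\<xi>. q \<xi> * weight n N \<xi>) \<in> C_fun n 2"
    by (rule C2_imp_C_fun) (rule C2_mult[OF q C2_weight])
  fix \<xi> assume "\<exists>i\<in>coords n. 1 + 2 * real N < \<bar>\<xi> i\<bar>"
  then obtain i where i: "i \<in> coords n" "1 + 2 * real N < \<bar>\<xi> i\<bar>" by auto
  have "(1 + 2 * real N) * 1 \<le> \<bar>\<xi> i\<bar> * \<bar>\<xi> i\<bar>" using i by (intro mult_mono) auto
  hence "real N \<le> energy n \<xi>" using coord_sq_le_energy[OF i(1), of \<xi>] by (simp add: power2_eq_square)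
  thus "q \<xi> * weight n N \<xi> = 0" using N by (simp add: weight_def cutoff_eq_0)
qed

text \<open>The cross terms of the bulk noise vanish by \<open>op_X_weight\<close>, so the only
  derivatives of \<open>q\<close> outside its own generator are those in \<open>p_0\<close> and
  \<open>p_n\<close>.\<close>

lemma generator_times_weight:
  assumes q: "C2 n q" and n: "n \<ge> 1"
  shows "generator \<gamma> \<gamma>b Tm Tp \<tau> n (\<lambda>\<xi>. q \<xi> * weight n N \<xi>) \<xi> =
    generator \<gamma> \<gamma>b Tm Tp \<tau> n q \<xi> * weight n N \<xi> + q \<xi> * generator \<gamma> \<gamma>b Tm Tp \<tau> n (weight n N) \<xi>
    + (real n)\<^sup>2 * (\<gamma>b * (Tm * partial (P 0) q \<xi> * partial (P 0) (weight n N) \<xi>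
      + Tp * partial (P n) q \<xi> * partial (P n) (weight n N) \<xi>))"
  unfolding generator_mult[OF q C2_weight n] by (simp add: op_X_weight)

lemma energy_bounded_integrable:
  assumes \<mu>: "prob_space \<mu>" "sets \<mu> = sets (Omega n)"
    and int: "\<And>i. i \<in> coords n \<Longrightarrow> integrable \<mu> (\<lambda>\<xi>. (\<xi> i)\<^sup>2)"
    and f: "continuous_on UNIV f" "energy_bounded n f"
  shows "integrable \<mu> f"
proof -
  interpret prob_space \<mu> by fact
  obtain C where C: "C \<ge> 0" "\<And>\<xi>. \<bar>f \<xi>\<bar> \<le> C * (1 + energy n \<xi>)"
    using f by (auto simp: energy_bounded_def)
  have "integrable \<mu> (\<lambda>\<xi>. C * (1 + energy n \<xi>))"
    unfolding energy_def using int by auto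
  thus ?thesis
  proof (rule Bochner_Integration.integrable_bound)
    show "f \<in> borel_measurable \<mu>"
      using continuous_on_imp_borel_Omega[OF f(1)] measurable_cong_sets[OF \<mu>(2) refl] by auto
    show "AE \<xi> in \<mu>. norm (f \<xi>) \<le> norm (C * (1 + energy n \<xi>))"
      using C energy_nonneg[of n] by (auto intro!: AE_I2 simp: abs_mult)
  qed
qed

text \<open>The products \<open>q * weight n N\<close> have compact support, so
  \<open>integral_generator_eq_0\<close> applies to them. As \<open>N\<close> grows their generators
  converge pointwise to that of \<open>q\<close> and are dominated by a multiple of
  \<open>1 + energy\<close>, which is integrable.\<close>

lemma integral_generator_quadratic_eq_0:
  assumes n: "n \<ge> 1"
    and K: "markov_semigroup (Omega n) K"
    and gen: "has_generator n K (generator \<gamma> \<gamma>b Tm Tp \<tau> n)"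
    and st: "stationary (Omega n) K \<mu>"
    and int: "\<And>i. i \<in> coords n \<Longrightarrow> integrable \<mu> (\<lambda>\<xi>. (\<xi> i)\<^sup>2)"
    and q: "C2 n q" "energy_bounded n q" "energy_bounded n (partial (P 0) q)"
      "energy_bounded n (partial (P n) q)"
    and Lq: "continuous_on UNIV (generator \<gamma> \<gamma>b Tm Tp \<tau> n q)"
      "energy_bounded n (generator \<gamma> \<gamma>b Tm Tp \<tau> n q)"
  shows "(\<integral>\<xi>. generator \<gamma> \<gamma>b Tm Tp \<tau> n q \<xi> \<partial>\<mu>) = 0"
proof -
  define L where "L = generator \<gamma> \<gamma>b Tm Tp \<tau> n"
  have \<mu>: "prob_space \<mu>" "sets \<mu> = sets (Omega n)"
    using st by (auto simp: stationary_def space_prob_algebra)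
  interpret \<mu>: prob_space \<mu> by fact
  obtain C1 where C1: "C1 \<ge> 0" "\<And>\<xi>. \<bar>q \<xi>\<bar> \<le> C1 * (1 + energy n \<xi>)"
    using q by (auto simp: energy_bounded_def)
  obtain C2 where C2: "C2 \<ge> 0" "\<And>\<xi>. \<bar>partial (P 0) q \<xi>\<bar> \<le> C2 * (1 + energy n \<xi>)"
    using q by (auto simp: energy_bounded_def)
  obtain C3 where C3: "C3 \<ge> 0" "\<And>\<xi>. \<bar>partial (P n) q \<xi>\<bar> \<le> C3 * (1 + energy n \<xi>)"
    using q by (auto simp: energy_bounded_def)
  obtain C4 where C4: "C4 \<ge> 0" "\<And>\<xi>. \<bar>L q \<xi>\<bar> \<le> C4 * (1 + energy n \<xi>)"
    using Lq by (auto simp: energy_bounded_def L_def)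
  define G where "G = (real n)\<^sup>2 * (9 * \<bar>\<tau>\<bar> + \<bar>\<gamma>b / 2\<bar> * (15 * \<bar>Tm\<bar> + 15 * \<bar>Tp\<bar> + 12))"
  define C where "C = C4 + C1 * G + (real n)\<^sup>2 * (\<bar>\<gamma>b\<bar> * (\<bar>Tm\<bar> * C2 * 9 + \<bar>Tp\<bar> * C3 * 9))"
  define f where "f = (\<lambda>N \<xi>. q \<xi> * weight n N \<xi>)"
  have G0: "G \<ge> 0" by (simp add: G_def)
  have C0: "C \<ge> 0" using C1 C2 C3 C4 G0 by (simp add: C_def)
  \<comment> \<open>Each summand of \<open>generator_times_weight\<close> is a factor of at most
    quadratic growth times a factor bounded uniformly in \<open>N\<close>.\<close>
  have bound: "\<bar>L (f N) \<xi>\<bar> \<le> C * (1 + energy n \<xi>)" if N: "N > 0" for N \<xi>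
  proof -
    define k where "k = 1 + energy n \<xi>"
    have w: "\<bar>weight n N \<xi>\<bar> \<le> 1"
      using cutoff_nonneg[of 3 N] cutoff_le_1[OF energy_nonneg, of 3 N n \<xi>] by (auto simp: weight_def)
    have k: "k \<ge> 0" using energy_nonneg[of n \<xi>] by (simp add: k_def)
    have 1: "\<bar>L q \<xi> * weight n N \<xi>\<bar> \<le> C4 * k * 1"
      unfolding abs_mult using C4 w k by (intro mult_mono) (auto simp: k_def)
    have 2: "\<bar>q \<xi> * L (weight n N) \<xi>\<bar> \<le> C1 * k * G"
      unfolding abs_mult using C1 k generator_weight_bound[OF n N]
      by (intro mult_mono) (auto simp: k_def L_def G_def)
    have 3: "\<bar>Tm * partial (P 0) q \<xi> * partial (P 0) (weight n N) \<xi>\<bar> \<le> \<bar>Tm\<bar> * (C2 * k) * 9"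
      unfolding abs_mult using C2 k partial_weight_bound[OF _ N, of "P 0" n \<xi>]
      by (intro mult_mono) (auto simp: k_def)
    have 4: "\<bar>Tp * partial (P n) q \<xi> * partial (P n) (weight n N) \<xi>\<bar> \<le> \<bar>Tp\<bar> * (C3 * k) * 9"
      unfolding abs_mult using C3 k partial_weight_bound[OF _ N, of "P n" n \<xi>]
      by (intro mult_mono) (auto simp: k_def)
    have "\<bar>(real n)\<^sup>2 * (\<gamma>b * (Tm * partial (P 0) q \<xi> * partial (P 0) (weight n N) \<xi>
      + Tp * partial (P n) q \<xi> * partial (P n) (weight n N) \<xi>))\<bar>
      \<le> (real n)\<^sup>2 * (\<bar>\<gamma>b\<bar> * (\<bar>Tm\<bar> * (C2 * k) * 9 + \<bar>Tp\<bar> * (C3 * k) * 9))"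
      unfolding abs_mult[of "_ ^ 2"] abs_mult[of \<gamma>b] using 3 4
      by (simp only: abs_power2) (intro mult_left_mono order_trans[OF abs_triangle_ineq] add_mono; simp)
    hence "\<bar>L (f N) \<xi>\<bar> \<le> C4 * k * 1 + C1 * k * G
        + (real n)\<^sup>2 * (\<bar>\<gamma>b\<bar> * (\<bar>Tm\<bar> * (C2 * k) * 9 + \<bar>Tp\<bar> * (C3 * k) * 9))"
      using 1 2 unfolding L_def f_def generator_times_weight[OF q(1) n] by linarith
    also have "\<dots> = C * k" by (simp add: C_def algebra_simps)
    finally show ?thesis by (simp add: k_def)
  qed
  \<comment> \<open>Every summand contains a cutoff that vanishes at energies from \<open>N\<close>
    on. Together with \<open>bound\<close> this makes \<open>L (f N)\<close> a bounded
    function.\<close>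
  have zero: "L (f N) \<xi> = 0" if N: "N > 0" and "energy n \<xi> \<ge> real N" for N \<xi>
    using cutoff_eq_0[of _ N "energy n \<xi>"] that
    unfolding L_def f_def generator_times_weight[OF q(1) n] generator_weight[OF n]
    by (simp add: partial_weight weight_def)
  have cont: "continuous_on UNIV (L (f N))" for N
  proof -
    have "continuous_on UNIV q" "continuous_on UNIV (partial (P 0) q)" "continuous_on UNIV (partial (P n) q)"
      "continuous_on UNIV (L q)" "continuous_on UNIV (weight n N)"
      "continuous_on UNIV (partial (P 0) (weight n N))" "continuous_on UNIV (partial (P n) (weight n N))"
      using q(1) Lq(1) C2_weight[of n N] by (auto simp: C2_def L_def)
    moreover have "continuous_on UNIV (L (weight n N))"
      unfolding L_def generator_weight[OF n, abs_def]
      by (intro continuous_intros continuous_on_coord continuous_on_cutoff)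
    ultimately show ?thesis
      unfolding L_def f_def generator_times_weight[OF q(1) n, abs_def] by (intro continuous_intros)
  qed
  have I0: "(\<integral>\<xi>. L (f N) \<xi> \<partial>\<mu>) = 0" if N: "N > 0" for N
  proof (rule integral_generator_eq_0[OF K st, where f = "f N"])
    show "((\<lambda>s. \<integral>\<eta>. f N \<eta> \<partial>K s \<xi>) has_real_derivative (\<integral>\<eta>. L (f N) \<eta> \<partial>K t \<xi>)) (at t within {0..})"
      if "\<xi> \<in> space (Omega n)" "t \<ge> 0" for \<xi> t
      using gen C_comp_times_weight[OF q(1) N] that unfolding has_generator_def f_def L_def by blast
    show "f N \<in> borel_measurable (Omega n)"
      using C2_mult[OF q(1) C2_weight[of n N]]
      by (intro continuous_on_imp_borel_Omega) (simp add: C2_def f_def)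
    show "L (f N) \<in> borel_measurable (Omega n)"
      by (rule continuous_on_imp_borel_Omega[OF cont])
    show "\<bar>f N \<xi>\<bar> \<le> C1 * (1 + real N)" for \<xi>
    proof -
      have "\<bar>q \<xi> * cutoff 3 N (energy n \<xi>)\<bar> \<le> C1 * (1 + real N)"
      proof (rule cutoff_times_bound)
        assume "energy n \<xi> < real N"
        hence "C1 * (1 + energy n \<xi>) \<le> C1 * (1 + real N)" using C1 by (intro mult_left_mono) auto
        thus "\<bar>q \<xi>\<bar> \<le> C1 * (1 + real N)" using C1(2)[of \<xi>] by linarith
      qed (use C1 N in auto)
      thus ?thesis by (simp add: f_def weight_def)
    qed
    show "\<bar>L (f N) \<xi>\<bar> \<le> C * (1 + real N)" for \<xi>
    proof (cases "energy n \<xi> \<ge> real N")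
      case False
      hence "C * (1 + energy n \<xi>) \<le> C * (1 + real N)" using C0 by (intro mult_left_mono) auto
      thus ?thesis using bound[OF N, of \<xi>] by linarith
    qed (use zero[OF N] C0 in auto)
  qed
  have "(\<lambda>N. \<integral>\<xi>. L (f (Suc N)) \<xi> \<partial>\<mu>) \<longlonglongrightarrow> (\<integral>\<xi>. L q \<xi> \<partial>\<mu>)"
  proof (rule integral_dominated_convergence[where w = "\<lambda>\<xi>. C * (1 + energy n \<xi>)"])
    show "L q \<in> borel_measurable \<mu>"
      using continuous_on_imp_borel_Omega[OF Lq(1)] measurable_cong_sets[OF \<mu>(2) refl]
      by (auto simp: L_def)
    show "L (f (Suc N)) \<in> borel_measurable \<mu>" for N
      using continuous_on_imp_borel_Omega[OF cont] measurable_cong_sets[OF \<mu>(2) refl] by auto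
    show "integrable \<mu> (\<lambda>\<xi>. C * (1 + energy n \<xi>))"
      unfolding energy_def using int by auto
    show "AE \<xi> in \<mu>. norm (L (f (Suc N)) \<xi>) \<le> C * (1 + energy n \<xi>)" for N
      using bound by auto
    show "AE \<xi> in \<mu>. (\<lambda>N. L (f (Suc N)) \<xi>) \<longlonglongrightarrow> L q \<xi>"
    proof (rule AE_I2)
      fix \<xi>
      have w: "(\<lambda>N. weight n (Suc N) \<xi>) \<longlonglongrightarrow> 1"
        unfolding weight_def by (rule LIMSEQ_Suc[OF cutoff_tendsto])
      have "(\<lambda>N. L (f (Suc N)) \<xi>) \<longlonglongrightarrow> L q \<xi> * 1 + q \<xi> * 0
        + (real n)\<^sup>2 * (\<gamma>b * (Tm * partial (P 0) q \<xi> * 0 + Tp * partial (P n) q \<xi> * 0))"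
        unfolding L_def f_def generator_times_weight[OF q(1) n]
        by (intro tendsto_intros w generator_weight_tendsto[OF n] partial_weight_tendsto) auto
      thus "(\<lambda>N. L (f (Suc N)) \<xi>) \<longlonglongrightarrow> L q \<xi>" by simp
    qed
  qed
  with I0 have "(\<lambda>N::nat. 0) \<longlonglongrightarrow> (\<integral>\<xi>. L q \<xi> \<partial>\<mu>)" by simp
  thus ?thesis by (simp add: LIMSEQ_const_iff L_def)
qed

section \<open>Moment equations\<close>

text \<open>The damping rate of \<open>p_x\<close>: \<open>\<gamma> / 2\<close> from each adjacent
  bond and \<open>\<gamma>b / 2\<close> from each thermostat at the site.\<close>

definition friction :: "real \<Rightarrow> real \<Rightarrow> nat \<Rightarrow> nat \<Rightarrow> real" where
  "friction \<gamma> \<gamma>b n x =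
    \<gamma> / 2 * (of_bool (0 < x) + of_bool (x < n)) + \<gamma>b / 2 * (of_bool (x = 0) + of_bool (x = n))"

text \<open>A linear functional of an arbitrary vector \<open>v\<close>, so that one formula serves
  configurations, means and columns of moment matrices. At the ends it reads the fictitious entries
  \<open>R 0\<close> and \<open>R (n + 1)\<close>.\<close>

definition drift :: "real \<Rightarrow> real \<Rightarrow> nat \<Rightarrow> coord \<Rightarrow> config \<Rightarrow> real" where
  "drift \<gamma> \<gamma>b n i v = (case i of
      R x \<Rightarrow> v (P x) - v (P (x - 1))
    | P x \<Rightarrow> v (R (x + 1)) - v (R x) - friction \<gamma> \<gamma>b n x * v (P x))"

text \<open>\<open>ext\<close> fixes the boundary values \<open>r\<^sub>0 = 0\<close> and \<open>r\<^sub>n\<^sub>+\<^sub>1 = \<tau>\<close>, which makes \<open>drift\<close>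
  uniform in \<open>x\<close>.\<close>

definition ext :: "real \<Rightarrow> nat \<Rightarrow> config \<Rightarrow> config" where
  "ext \<tau> n \<xi> i = (if i \<in> coords n then \<xi> i else if i = R (Suc n) then \<tau> else 0)"

text \<open>The carre du champ of the coordinates \<open>i\<close> and \<open>j\<close>, up to the
  factor \<open>n^2\<close>. It is affine in the matrix \<open>M\<close> of products, so
  expectations can be taken inside.\<close>

definition noise :: "real \<Rightarrow> real \<Rightarrow> real \<Rightarrow> real \<Rightarrow> nat \<Rightarrow> (coord \<Rightarrow> coord \<Rightarrow> real) \<Rightarrow> coord \<Rightarrow> coord \<Rightarrow> real"
  where "noise \<gamma> \<gamma>b Tm Tp n M i j =
    \<gamma> * (\<Sum>x<n. of_bool (i = P x) * of_bool (j = P x) * M (P (x + 1)) (P (x + 1))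
      - of_bool (i = P x) * of_bool (j = P (x + 1)) * M (P (x + 1)) (P x)
      - of_bool (i = P (x + 1)) * of_bool (j = P x) * M (P x) (P (x + 1))
      + of_bool (i = P (x + 1)) * of_bool (j = P (x + 1)) * M (P x) (P x))
    + \<gamma>b * (Tm * of_bool (i = P 0) * of_bool (j = P 0) + Tp * of_bool (i = P n) * of_bool (j = P n))"

lemma op_X_coord:
  "op_X x (\<lambda>\<xi>. \<xi> i) = (\<lambda>\<xi>. of_bool (i = P x) * \<xi> (P (x + 1)) - of_bool (i = P (x + 1)) * \<xi> (P x))"
  by (auto simp: op_X_def partial_coord fun_eq_iff)

text \<open>The square of the rotation generator is minus the identity on the two momenta that it
  rotates and zero on the other coordinates.\<close>

lemma op_X_op_X_coord:
  "op_X x (op_X x (\<lambda>\<xi>. \<xi> i)) \<xi> = - (of_bool (i = P x) + of_bool (i = P (x + 1))) * \<xi> i"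
proof -
  have "op_X x (op_X x (\<lambda>\<xi>. \<xi> i)) = (\<lambda>\<xi>. - (of_bool (i = P x) + of_bool (i = P (x + 1))) * \<xi> i)"
    (is "op_X x ?f = _")
  proof -
    consider "i = P x" | "i = P (x + 1)" | "i \<noteq> P x" "i \<noteq> P (x + 1)" by blast
    thus ?thesis
    proof cases
      case 1
      hence f: "?f = (\<lambda>\<xi>. \<xi> (P (x + 1)))" by (simp add: op_X_coord)
      show ?thesis unfolding f using 1 by (auto simp: op_X_coord fun_eq_iff)
    next
      case 2
      hence f: "?f = (\<lambda>\<xi>. - \<xi> (P x))" by (simp add: op_X_coord)
      have "has_partial k (\<lambda>\<xi>. - \<xi> (P x)) (\<lambda>_. - (if P x = k then 1 else 0))" for k
        using has_partial_mult[OF has_partial_const[of k "-1"] has_partial_coord[of k "P x"]] by simp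
      hence "partial k (\<lambda>\<xi>. - \<xi> (P x)) = (\<lambda>_. - (if P x = k then 1 else 0))" for k
        by (rule has_partial_imp_partial)
      thus ?thesis unfolding f using 2 by (auto simp: op_X_def fun_eq_iff)
    next
      case 3
      hence f: "?f = (\<lambda>_. 0)" by (simp add: op_X_coord)
      show ?thesis unfolding f using 3 by (auto simp: op_X_def partial_const fun_eq_iff)
    qed
  qed
  thus ?thesis by simp
qed

text \<open>With both noise parameters set to 0 the friction vanishes and \<open>drift\<close> is
  the Hamiltonian part alone.\<close>

lemma op_A_coord:
  assumes "n \<ge> 1" "i \<in> coords n"
  shows "op_A \<tau> n (\<lambda>\<xi>. \<xi> i) \<xi> = drift 0 0 n i (ext \<tau> n \<xi>)"
proof (cases i)
  case (R y)
  thus ?thesis using assms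
    by (auto simp: op_A_def partial_coord drift_def ext_def friction_def if_distrib[of "(*) _"] cong: if_cong)
next
  case (P y)
  consider "y = 0" | "y = n" "y \<noteq> 0" | "1 \<le> y" "y \<le> n - 1" using assms P by fastforce
  thus ?thesis
    by cases (use P assms in \<open>auto simp: op_A_def partial_coord drift_def ext_def friction_def
      if_distrib[of "(*) _"] cong: if_cong\<close>)
qed

text \<open>Each bond adjacent to \<open>x\<close>, two in the bulk and one at an end, contributes
  \<open>- p_x\<close>.\<close>

lemma op_S_coord:
  assumes "n \<ge> 1" "i \<in> coords n"
  shows "op_S n (\<lambda>\<xi>. \<xi> i) \<xi> = (case i of R x \<Rightarrow> 0 | P x \<Rightarrow> - (of_bool (0 < x) + of_bool (x < n)) * \<xi> (P x))"
proof (cases i)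
  case (P y)
  have "(\<Sum>x<n. of_bool (y = x) + of_bool (y = x + 1) :: real) = of_bool (0 < y) + of_bool (y < n)"
  proof -
    have "(\<Sum>x<n. of_bool (y = x) :: real) = of_bool (y < n)"
      by (simp add: of_bool_def sum.delta)
    moreover have "(\<Sum>x<n. of_bool (y = x + 1) :: real) = of_bool (0 < y)"
    proof (cases y)
      case (Suc k)
      thus ?thesis using assms P by (simp add: of_bool_def sum.delta)
    qed simp
    ultimately show ?thesis by (simp add: sum.distrib)
  qed
  moreover have "op_S n (\<lambda>\<xi>. \<xi> i) \<xi> = - (\<Sum>x<n. of_bool (y = x) + of_bool (y = x + 1)) * \<xi> i"
    unfolding op_S_def op_X_op_X_coord P by (simp add: sum_distrib_right flip: sum_negf)
  ultimately show ?thesis using P by simp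
qed (simp add: op_S_def op_X_op_X_coord)

lemma generator_coord:
  assumes "n \<ge> 1" "i \<in> coords n"
  shows "generator \<gamma> \<gamma>b Tm Tp \<tau> n (\<lambda>\<xi>. \<xi> i) \<xi> = (real n)\<^sup>2 * drift \<gamma> \<gamma>b n i (ext \<tau> n \<xi>)"
  unfolding generator_def op_A_coord[OF assms] op_S_coord[OF assms] op_S_bdry_def
  using assms
  by (cases i)
     (auto simp: partial_coord partial_const drift_def friction_def ext_def algebra_simps of_bool_def)

lemma generator_coord_mult:
  assumes n: "n \<ge> 1" and i: "i \<in> coords n" and j: "j \<in> coords n"
  shows "generator \<gamma> \<gamma>b Tm Tp \<tau> n (\<lambda>\<xi>. \<xi> i * \<xi> j) \<xi> = (real n)\<^sup>2 *
    (drift \<gamma> \<gamma>b n i (\<lambda>k. ext \<tau> n \<xi> k * ext \<tau> n \<xi> j) + drift \<gamma> \<gamma>b n j (\<lambda>k. ext \<tau> n \<xi> k * ext \<tau> n \<xi> i)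
     + noise \<gamma> \<gamma>b Tm Tp n (\<lambda>k l. ext \<tau> n \<xi> k * ext \<tau> n \<xi> l) i j)"
proof -
  have e: "ext \<tau> n \<xi> i = \<xi> i" "ext \<tau> n \<xi> j = \<xi> j" using i j by (auto simp: ext_def)
  have d: "drift \<gamma> \<gamma>b n i' (\<lambda>k. v k * c) = drift \<gamma> \<gamma>b n i' v * c" for i' v c
    by (cases i') (auto simp: drift_def algebra_simps)
  have "(\<Sum>x<n. op_X x (\<lambda>\<xi>. \<xi> i) \<xi> * op_X x (\<lambda>\<xi>. \<xi> j) \<xi>) =
     (\<Sum>x<n. of_bool (i = P x) * of_bool (j = P x) * (ext \<tau> n \<xi> (P (x + 1)) * ext \<tau> n \<xi> (P (x + 1)))
      - of_bool (i = P x) * of_bool (j = P (x + 1)) * (ext \<tau> n \<xi> (P (x + 1)) * ext \<tau> n \<xi> (P x))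
      - of_bool (i = P (x + 1)) * of_bool (j = P x) * (ext \<tau> n \<xi> (P x) * ext \<tau> n \<xi> (P (x + 1)))
      + of_bool (i = P (x + 1)) * of_bool (j = P (x + 1)) * (ext \<tau> n \<xi> (P x) * ext \<tau> n \<xi> (P x)))"
    by (rule sum.cong) (auto simp: op_X_coord ext_def algebra_simps)
  moreover have "Tm * partial (P 0) (\<lambda>\<xi>. \<xi> i) \<xi> * partial (P 0) (\<lambda>\<xi>. \<xi> j) \<xi>
      + Tp * partial (P n) (\<lambda>\<xi>. \<xi> i) \<xi> * partial (P n) (\<lambda>\<xi>. \<xi> j) \<xi> =
      Tm * of_bool (i = P 0) * of_bool (j = P 0) + Tp * of_bool (i = P n) * of_bool (j = P n)"
    by (auto simp: partial_coord)
  ultimately show ?thesis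
    unfolding generator_mult[OF C2_coord C2_coord n] generator_coord[OF n i] generator_coord[OF n j]
      noise_def d e
    by (simp add: algebra_simps)
qed

section \<open>Growth, continuity and integrals of drift and noise\<close>

lemma energy_bounded_const: "energy_bounded n (\<lambda>_. c)"
proof -
  have "\<bar>c\<bar> \<le> \<bar>c\<bar> * (1 + energy n \<xi>)" for \<xi>
    using mult_left_mono[of 1 "1 + energy n \<xi>" "\<bar>c\<bar>"] energy_nonneg[of n \<xi>] by simp
  thus ?thesis unfolding energy_bounded_def by (intro exI[of _ "\<bar>c\<bar>"]) auto
qed

lemma energy_bounded_add:
  assumes "energy_bounded n f" "energy_bounded n g"
  shows "energy_bounded n (\<lambda>\<xi>. f \<xi> + g \<xi>)"
proof -
  obtain C D where "C \<ge> 0" "D \<ge> 0" "\<And>\<xi>. \<bar>f \<xi>\<bar> \<le> C * (1 + energy n \<xi>)" "\<And>\<xi>. \<bar>g \<xi>\<bar> \<le> D * (1 + energy n \<xi>)"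
    using assms by (auto simp: energy_bounded_def)
  moreover from this(3,4) have "\<bar>f \<xi> + g \<xi>\<bar> \<le> (C + D) * (1 + energy n \<xi>)" for \<xi>
    using add_mono[of "\<bar>f \<xi>\<bar>" _ "\<bar>g \<xi>\<bar>"] abs_triangle_ineq[of "f \<xi>" "g \<xi>"]
    by (simp only: distrib_right) (meson order_trans)
  ultimately show ?thesis unfolding energy_bounded_def by (intro exI[of _ "C + D"]) auto
qed

lemma energy_bounded_cmult:
  assumes "energy_bounded n f"
  shows "energy_bounded n (\<lambda>\<xi>. c * f \<xi>)"
proof -
  obtain C where C: "C \<ge> 0" "\<And>\<xi>. \<bar>f \<xi>\<bar> \<le> C * (1 + energy n \<xi>)"
    using assms by (auto simp: energy_bounded_def)
  have "\<bar>c * f \<xi>\<bar> \<le> (\<bar>c\<bar> * C) * (1 + energy n \<xi>)" for \<xi>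
    using mult_left_mono[OF C(2)[of \<xi>], of "\<bar>c\<bar>"] by (simp add: abs_mult mult_ac)
  thus ?thesis using C(1) unfolding energy_bounded_def by (intro exI[of _ "\<bar>c\<bar> * C"]) auto
qed

lemma energy_bounded_diff:
  "energy_bounded n f \<Longrightarrow> energy_bounded n g \<Longrightarrow> energy_bounded n (\<lambda>\<xi>. f \<xi> - g \<xi>)"
  using energy_bounded_add[OF _ energy_bounded_cmult[of n g "-1"]] by simp

lemma energy_bounded_sum:
  "(\<And>x. x \<in> A \<Longrightarrow> energy_bounded n (f x)) \<Longrightarrow> energy_bounded n (\<lambda>\<xi>. \<Sum>x\<in>A. f x \<xi>)"
  by (induction A rule: infinite_finite_induct) (auto intro!: energy_bounded_add energy_bounded_const)

lemma energy_bounded_coord: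
  assumes "i \<in> coords n" shows "energy_bounded n (\<lambda>\<xi>. \<xi> i)"
proof -
  have "\<bar>\<xi> i\<bar> \<le> 1 * (1 + energy n \<xi>)" for \<xi>
    using coord_sq_le_energy[OF assms, of \<xi>] zero_le_power2[of "\<bar>\<xi> i\<bar> - 1"]
    by (simp add: power2_eq_square algebra_simps)
  thus ?thesis unfolding energy_bounded_def by (intro exI[of _ 1]) auto
qed

lemma energy_bounded_coord_mult:
  assumes "i \<in> coords n" "j \<in> coords n" shows "energy_bounded n (\<lambda>\<xi>. \<xi> i * \<xi> j)"
proof -
  have "\<bar>\<xi> i * \<xi> j\<bar> \<le> 2 * (1 + energy n \<xi>)" for \<xi>
    using coord_sq_le_energy[OF assms(1), of \<xi>] coord_sq_le_energy[OF assms(2), of \<xi>]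
      zero_le_power2[of "\<bar>\<xi> i\<bar> - \<bar>\<xi> j\<bar>"]
    by (simp add: abs_mult power2_eq_square algebra_simps)
  thus ?thesis unfolding energy_bounded_def by (intro exI[of _ 2]) auto
qed

lemma energy_bounded_ext: "energy_bounded n (\<lambda>\<xi>. ext \<tau> n \<xi> i)"
  unfolding ext_def
  by (cases "i \<in> coords n") (auto intro: energy_bounded_coord energy_bounded_const)

lemma energy_bounded_ext_mult: "energy_bounded n (\<lambda>\<xi>. ext \<tau> n \<xi> i * ext \<tau> n \<xi> j)"
proof (cases "i \<in> coords n \<and> j \<in> coords n")
  case True
  thus ?thesis by (simp add: ext_def energy_bounded_coord_mult)
next
  case False
  hence "(\<exists>c. \<forall>\<xi>. ext \<tau> n \<xi> i = c) \<or> (\<exists>c. \<forall>\<xi>. ext \<tau> n \<xi> j = c)"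
    by (auto simp: ext_def)
  thus ?thesis
  proof
    assume "\<exists>c. \<forall>\<xi>. ext \<tau> n \<xi> i = c"
    then obtain c where "\<And>\<xi>. ext \<tau> n \<xi> i = c" by blast
    thus ?thesis using energy_bounded_cmult[OF energy_bounded_ext[of n \<tau> j], of c] by simp
  next
    assume "\<exists>c. \<forall>\<xi>. ext \<tau> n \<xi> j = c"
    then obtain c where "\<And>\<xi>. ext \<tau> n \<xi> j = c" by blast
    thus ?thesis using energy_bounded_cmult[OF energy_bounded_ext[of n \<tau> i], of c] by (simp add: mult.commute)
  qed
qed

lemma continuous_on_ext: "continuous_on A (\<lambda>\<xi>. ext \<tau> n \<xi> i)"
  unfolding ext_def by (cases "i \<in> coords n") (auto intro: continuous_on_coord)

lemma energy_bounded_drift: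
  "(\<And>k. energy_bounded n (\<lambda>\<xi>. v \<xi> k)) \<Longrightarrow> energy_bounded n (\<lambda>\<xi>. drift \<gamma> \<gamma>b n i (v \<xi>))"
  by (cases i) (auto simp: drift_def intro!: energy_bounded_diff energy_bounded_cmult)

lemma continuous_on_drift:
  "(\<And>k. continuous_on A (\<lambda>\<xi>. v \<xi> k)) \<Longrightarrow> continuous_on A (\<lambda>\<xi>. drift \<gamma> \<gamma>b n i (v \<xi>))"
  by (cases i) (auto simp: drift_def intro!: continuous_intros)

lemma integral_drift:
  assumes "\<And>k. integrable \<mu> (\<lambda>\<xi>. v \<xi> k)"
  shows "integrable \<mu> (\<lambda>\<xi>. drift \<gamma> \<gamma>b n i (v \<xi>))"
    and "(\<integral>\<xi>. drift \<gamma> \<gamma>b n i (v \<xi>) \<partial>\<mu>) = drift \<gamma> \<gamma>b n i (\<lambda>k. \<integral>\<xi>. v \<xi> k \<partial>\<mu>)"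
  using assms by (cases i; simp add: drift_def)+

lemma energy_bounded_noise:
  assumes "\<And>k l. energy_bounded n (\<lambda>\<xi>. M \<xi> k l)"
  shows "energy_bounded n (\<lambda>\<xi>. noise \<gamma> \<gamma>b Tm Tp n (M \<xi>) i j)"
  unfolding noise_def
  by (intro energy_bounded_add energy_bounded_cmult energy_bounded_sum energy_bounded_diff
      energy_bounded_const assms)

lemma continuous_on_noise:
  assumes "\<And>k l. continuous_on A (\<lambda>\<xi>. M \<xi> k l)"
  shows "continuous_on A (\<lambda>\<xi>. noise \<gamma> \<gamma>b Tm Tp n (M \<xi>) i j)"
  unfolding noise_def by (intro continuous_intros assms)

lemma (in prob_space) integral_noise:
  assumes "\<And>k l. integrable M (\<lambda>\<xi>. v \<xi> k l)"
  shows "integrable M (\<lambda>\<xi>. noise \<gamma> \<gamma>b Tm Tp n (v \<xi>) i j)"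
    and "(\<integral>\<xi>. noise \<gamma> \<gamma>b Tm Tp n (v \<xi>) i j \<partial>M) = noise \<gamma> \<gamma>b Tm Tp n (\<lambda>k l. \<integral>\<xi>. v \<xi> k l \<partial>M) i j"
  using assms by (simp_all add: noise_def prob_space)

text \<open>The test functions are the coordinates and their pairwise products; the common factor
  \<open>n^2\<close> is cancelled. Both \<open>m\<close> and \<open>M\<close> include the fictitious
  entries supplied by \<open>ext\<close>, so no boundary cases appear.\<close>

lemma stationary_moment_equations:
  fixes \<mu> :: "config measure" and \<tau> :: real and n :: nat
  defines "m \<equiv> \<lambda>i. \<integral>\<xi>. ext \<tau> n \<xi> i \<partial>\<mu>"
    and "M \<equiv> \<lambda>i j. \<integral>\<xi>. ext \<tau> n \<xi> i * ext \<tau> n \<xi> j \<partial>\<mu>"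
  assumes n: "n \<ge> 1"
    and K: "markov_semigroup (Omega n) K"
    and gen: "has_generator n K (generator \<gamma> \<gamma>b Tm Tp \<tau> n)"
    and st: "stationary (Omega n) K \<mu>"
    and int: "\<And>i. i \<in> coords n \<Longrightarrow> integrable \<mu> (\<lambda>\<xi>. (\<xi> i)\<^sup>2)"
  shows "\<And>i. integrable \<mu> (\<lambda>\<xi>. ext \<tau> n \<xi> i)"
    and "\<And>i j. integrable \<mu> (\<lambda>\<xi>. ext \<tau> n \<xi> i * ext \<tau> n \<xi> j)"
    and "\<And>i. i \<in> coords n \<Longrightarrow> drift \<gamma> \<gamma>b n i m = 0"
    and "\<And>i j. i \<in> coords n \<Longrightarrow> j \<in> coords n \<Longrightarrow>
      drift \<gamma> \<gamma>b n i (\<lambda>k. M k j) + drift \<gamma> \<gamma>b n j (\<lambda>k. M k i) + noise \<gamma> \<gamma>b Tm Tp n M i j = 0"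
proof -
  have \<mu>: "prob_space \<mu>" "sets \<mu> = sets (Omega n)"
    using st by (auto simp: stationary_def space_prob_algebra)
  interpret \<mu>: prob_space \<mu> by fact
  note int' = energy_bounded_integrable[OF \<mu> int]
  show i1: "integrable \<mu> (\<lambda>\<xi>. ext \<tau> n \<xi> i)" for i
    by (intro int' continuous_on_ext energy_bounded_ext)
  show i2: "integrable \<mu> (\<lambda>\<xi>. ext \<tau> n \<xi> i * ext \<tau> n \<xi> j)" for i j
    by (intro int' continuous_on_mult continuous_on_ext energy_bounded_ext_mult)
  note zero = integral_generator_quadratic_eq_0[OF n K gen st int]
  show "drift \<gamma> \<gamma>b n i m = 0" if i: "i \<in> coords n" for i
  proof -
    have "(\<integral>\<xi>. generator \<gamma> \<gamma>b Tm Tp \<tau> n (\<lambda>\<xi>. \<xi> i) \<xi> \<partial>\<mu>) = 0"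
    proof (rule zero)
      show "energy_bounded n (partial (P 0) (\<lambda>\<xi>. \<xi> i))" "energy_bounded n (partial (P n) (\<lambda>\<xi>. \<xi> i))"
        by (simp_all add: partial_coord energy_bounded_const)
    qed (auto simp: generator_coord[OF n i, abs_def] C2_coord energy_bounded_coord[OF i]
        intro!: continuous_intros continuous_on_drift continuous_on_ext
          energy_bounded_cmult energy_bounded_drift energy_bounded_ext)
    thus ?thesis
      using n by (simp add: generator_coord[OF n i] integral_drift(2)[OF i1] m_def)
  qed
  show "drift \<gamma> \<gamma>b n i (\<lambda>k. M k j) + drift \<gamma> \<gamma>b n j (\<lambda>k. M k i) + noise \<gamma> \<gamma>b Tm Tp n M i j = 0"
    if i: "i \<in> coords n" and j: "j \<in> coords n" for i j
  proof -
    have "(\<integral>\<xi>. generator \<gamma> \<gamma>b Tm Tp \<tau> n (\<lambda>\<xi>. \<xi> i * \<xi> j) \<xi> \<partial>\<mu>) = 0"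
    proof (rule zero)
      have "energy_bounded n (partial k (\<lambda>\<xi>. \<xi> i * \<xi> j))" if "k \<in> coords n" for k
        using i j
        by (auto simp: partial_mult[OF pdiff_coord pdiff_coord that] partial_coord
            intro!: energy_bounded_add energy_bounded_cmult energy_bounded_coord energy_bounded_const)
      thus "energy_bounded n (partial (P 0) (\<lambda>\<xi>. \<xi> i * \<xi> j))"
        "energy_bounded n (partial (P n) (\<lambda>\<xi>. \<xi> i * \<xi> j))" by auto
    qed (auto simp: generator_coord_mult[OF n i j, abs_def] energy_bounded_coord_mult[OF i j]
        intro!: C2_mult C2_coord continuous_intros continuous_on_drift continuous_on_ext
          energy_bounded_cmult energy_bounded_add energy_bounded_drift energy_bounded_ext_mult
          continuous_on_noise energy_bounded_noise)
    hence "(\<integral>\<xi>. drift \<gamma> \<gamma>b n i (\<lambda>k. ext \<tau> n \<xi> k * ext \<tau> n \<xi> j)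
        + drift \<gamma> \<gamma>b n j (\<lambda>k. ext \<tau> n \<xi> k * ext \<tau> n \<xi> i)
        + noise \<gamma> \<gamma>b Tm Tp n (\<lambda>k l. ext \<tau> n \<xi> k * ext \<tau> n \<xi> l) i j \<partial>\<mu>) = 0"
      using n by (simp add: generator_coord_mult[OF n i j])
    thus ?thesis
      by (simp add: integral_drift[OF i2] \<mu>.integral_noise[OF i2] M_def)
  qed
qed

text \<open>Expresses that the Hamiltonian drift is antisymmetric up to terms at the fictitious
  elongations \<open>r 0\<close> and \<open>r (n + 1)\<close>.\<close>

lemma sum_by_parts:
  fixes p r :: "nat \<Rightarrow> real"
  shows "(\<Sum>x=1..n. r x * (p x - p (x - 1))) + (\<Sum>x\<le>n. p x * (r (x + 1) - r x)) =
    r (Suc n) * p n - r 0 * p 0"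
  by (induction n) (simp_all add: algebra_simps)

lemma sum_of_bool_eq:
  assumes "finite A" "a \<in> A"
  shows "(\<Sum>i\<in>A. of_bool (i = a) * f i) = (f a :: real)"
  using assms by (simp add: of_bool_def if_distrib[of "\<lambda>u. u * _"] sum.delta cong: if_cong)

text \<open>Used to bound bulk variances by a boundary variance and the gradients that the
  dissipation controls.\<close>

lemma abs_le_initial_plus_variation:
  fixes f :: "nat \<Rightarrow> real"
  assumes "x \<le> n"
  shows "\<bar>f x\<bar> \<le> \<bar>f 0\<bar> + (\<Sum>y<n. \<bar>f y - f (Suc y)\<bar>)"
proof -
  have "\<bar>f x\<bar> \<le> \<bar>f 0\<bar> + (\<Sum>y<x. \<bar>f y - f (Suc y)\<bar>)" by (induction x) auto
  also have "(\<Sum>y<x. \<bar>f y - f (Suc y)\<bar>) \<le> (\<Sum>y<n. \<bar>f y - f (Suc y)\<bar>)"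
    using assms by (intro sum_mono2) auto
  finally show ?thesis by simp
qed

lemma sum_swap3:
  "(\<Sum>i\<in>A. \<Sum>k\<in>B. \<Sum>x\<in>D. f i k x) = (\<Sum>x\<in>D. \<Sum>i\<in>A. \<Sum>k\<in>B. f i k x)"
proof -
  have "(\<Sum>k\<in>B. \<Sum>x\<in>D. f i k x) = (\<Sum>x\<in>D. \<Sum>k\<in>B. f i k x)" for i
    by (rule sum.swap)
  thus ?thesis by (simp only:) (rule sum.swap)
qed

section \<open>Means and currents as consequences of the moment equations\<close>

text \<open>Separates the linear algebra from the measure: only the moment equations, the symmetry
  of \<open>M\<close> and the boundary values of \<open>m\<close> and \<open>M\<close> are
  retained.\<close>

locale moment_system =
  fixes \<gamma> \<gamma>b Tm Tp \<tau> :: real and n :: nat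
    and m :: "coord \<Rightarrow> real" and M :: "coord \<Rightarrow> coord \<Rightarrow> real"
  assumes \<gamma>_pos: "\<gamma> > 0" and \<gamma>b_pos: "\<gamma>b > 0" and n_pos: "n \<ge> 1"
    and M_commute: "M i j = M j i"
    and m_left: "m (R 0) = 0" and m_right: "m (R (Suc n)) = \<tau>"
    and M_left: "M (R 0) i = 0" and M_right: "M (R (Suc n)) i = \<tau> * m i"
    and mean_eq: "i \<in> coords n \<Longrightarrow> drift \<gamma> \<gamma>b n i m = 0"
    and moment_eq: "i \<in> coords n \<Longrightarrow> j \<in> coords n \<Longrightarrow>
      drift \<gamma> \<gamma>b n i (\<lambda>k. M k j) + drift \<gamma> \<gamma>b n j (\<lambda>k. M k i) + noise \<gamma> \<gamma>b Tm Tp n M i j = 0"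
begin

abbreviation fr where "fr \<equiv> friction \<gamma> \<gamma>b n"

definition pbar where "pbar = m (P 0)"

text \<open>The average of the current from the left thermostat. \<open>bulk_current\<close> and
  \<open>right_current\<close> show that all other currents have the same average.\<close>

definition j where "j = \<gamma>b / 2 * (Tm - M (P 0) (P 0))"

definition C where "C i k = M i k - m i * m k"

lemma m_P: "x \<le> n \<Longrightarrow> m (P x) = pbar"
proof (induction x)
  case (Suc x)
  thus ?case using mean_eq[of "R (Suc x)"] by (simp add: drift_def)
qed (simp add: pbar_def)

lemma m_R_step: "x \<le> n \<Longrightarrow> m (R (Suc x)) = m (R x) + fr x * pbar"
  using mean_eq[of "P x"] by (simp add: drift_def m_P)

lemma friction_0: "fr 0 = (\<gamma> + \<gamma>b) / 2"
  and friction_n: "fr n = (\<gamma> + \<gamma>b) / 2"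
  using n_pos by (auto simp: friction_def)

lemma m_R_1: "m (R 1) = (\<gamma> + \<gamma>b) / 2 * pbar"
  using m_R_step[of 0] by (simp add: friction_0 m_left)

lemma m_R_n: "m (R n) = \<tau> - (\<gamma> + \<gamma>b) / 2 * pbar"
  using m_R_step[of n] by (simp add: friction_n m_right)

text \<open>The mean elongation rises by \<open>fr x * pbar\<close> at site \<open>x\<close>, from 0
  on the left to \<open>\<tau>\<close> on the right, and the friction coefficients add up to
  \<open>n * \<gamma> + \<gamma>b\<close>.\<close>

lemma pbar_eq: "(real n * \<gamma> + \<gamma>b) * pbar = \<tau>"
proof -
  have "m (R x) = (\<gamma> + \<gamma>b) / 2 * pbar + (real x - 1) * \<gamma> * pbar" if "1 \<le> x" "x \<le> n" for x
    using that
  proof (induction x rule: nat_induct_at_least)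
    case base
    thus ?case using m_R_1 by simp
  next
    case (Suc x)
    thus ?case using m_R_step[of x] by (simp add: friction_def algebra_simps)
  qed
  from this[of n] m_R_n n_pos show ?thesis by (simp add: field_simps)
qed

lemma noise_R: "noise \<gamma> \<gamma>b Tm Tp n M' (R x) i = 0" "noise \<gamma> \<gamma>b Tm Tp n M' i (R x) = 0"
  by (simp_all add: noise_def)

lemma noise_P_P:
  assumes "x \<le> n"
  shows "noise \<gamma> \<gamma>b Tm Tp n M (P x) (P x) =
    \<gamma> * (of_bool (x < n) * M (P (x + 1)) (P (x + 1)) + of_bool (0 < x) * M (P (x - 1)) (P (x - 1)))
    + \<gamma>b * (Tm * of_bool (x = 0) + Tp * of_bool (x = n))"
proof -
  have "(\<Sum>y<n. of_bool (x = y) * M (P (y + 1)) (P (y + 1))) = of_bool (x < n) * M (P (x + 1)) (P (x + 1))"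
    by (simp add: of_bool_def if_distrib[of "\<lambda>u. u * _"] sum.delta cong: if_cong)
  moreover have "(\<Sum>y<n. of_bool (x = y + 1) * M (P y) (P y)) = of_bool (0 < x) * M (P (x - 1)) (P (x - 1))"
  proof (cases x)
    case (Suc k)
    thus ?thesis using assms
      by (simp add: of_bool_def if_distrib[of "\<lambda>u. u * _"] sum.delta cong: if_cong)
  qed simp
  moreover have "(\<Sum>y<n. of_bool (P x = P y) * of_bool (P x = P y) * M (P (y + 1)) (P (y + 1))
      - of_bool (P x = P y) * of_bool (P x = P (y + 1)) * M (P (y + 1)) (P y)
      - of_bool (P x = P (y + 1)) * of_bool (P x = P y) * M (P y) (P (y + 1))
      + of_bool (P x = P (y + 1)) * of_bool (P x = P (y + 1)) * M (P y) (P y)) =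
      (\<Sum>y<n. of_bool (x = y) * M (P (y + 1)) (P (y + 1)) + of_bool (x = y + 1) * M (P y) (P y))"
    by (rule sum.cong) auto
  ultimately have "noise \<gamma> \<gamma>b Tm Tp n M (P x) (P x) =
    \<gamma> * (of_bool (x < n) * M (P (x + 1)) (P (x + 1)) + of_bool (0 < x) * M (P (x - 1)) (P (x - 1)))
    + \<gamma>b * (Tm * of_bool (P x = P 0) * of_bool (P x = P 0) + Tp * of_bool (P x = P n) * of_bool (P x = P n))"
    by (simp only: noise_def sum.distrib)
  thus ?thesis by (auto simp: of_bool_def)
qed

text \<open>The stationary equation for the square of \<open>r_x\<close>, on which no noise
  acts.\<close>

lemma M_R_P: "1 \<le> x \<Longrightarrow> x \<le> n \<Longrightarrow> M (P x) (R x) = M (P (x - 1)) (R x)"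
  using moment_eq[of "R x" "R x"] by (simp add: noise_R drift_def)

lemma kinetic_balance:
  assumes "x \<le> n"
  shows "2 * (M (P x) (R (x + 1)) - M (P x) (R x)) - 2 * fr x * M (P x) (P x)
    + \<gamma> * (of_bool (x < n) * M (P (x + 1)) (P (x + 1)) + of_bool (0 < x) * M (P (x - 1)) (P (x - 1)))
    + \<gamma>b * (Tm * of_bool (x = 0) + Tp * of_bool (x = n)) = 0"
  using moment_eq[of "P x" "P x"] assms
  by (simp add: noise_P_P drift_def M_commute[of "R _"] algebra_simps)

text \<open>After \<open>M_R_P\<close>, the balance of kinetic energy at a site says that the
  incoming and the outgoing current agree; induction starts at the left thermostat.\<close>

lemma bulk_current:
  "x < n \<Longrightarrow> - M (P x) (R (x + 1)) + \<gamma> / 2 * (M (P x) (P x) - M (P (x + 1)) (P (x + 1))) = j"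
proof (induction x)
  case 0
  thus ?case using kinetic_balance[of 0]
    by (simp add: j_def friction_0 M_commute[of _ "R 0"] M_left field_simps)
next
  case (Suc x)
  hence IH: "- M (P x) (R (x + 1)) + \<gamma> / 2 * (M (P x) (P x) - M (P (x + 1)) (P (x + 1))) = j" by simp
  show ?case
    using Suc.prems kinetic_balance[of "Suc x"] IH M_R_P[of "Suc x"]
    by (simp add: friction_def field_simps)
qed

lemma right_current: "- \<gamma>b / 2 * (Tp - M (P n) (P n)) - \<tau> * pbar = j"
proof -
  obtain k where k: "n = Suc k" using n_pos by (cases n) auto
  have "M (P n) (R (Suc n)) = \<tau> * pbar" using M_right[of "P n"] M_commute m_P[of n] by simp
  moreover note kinetic_balance[of n, unfolded friction_n]
  ultimately show ?thesis
    using bulk_current[of k] M_R_P[of n] k by (simp add: field_simps)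
qed

text \<open>The Hamiltonian part of the current, with opposite sign.\<close>

definition J where "J x = M (P x) (R (x + 1))"

lemma current_sum: "real n * j = - (\<Sum>x<n. J x) + \<gamma> / 2 * (M (P 0) (P 0) - M (P n) (P n))"
proof -
  have "real n * j = (\<Sum>x<n. - J x + \<gamma> / 2 * (M (P x) (P x) - M (P (Suc x)) (P (Suc x))))"
    using bulk_current by (simp add: J_def)
  also have "\<dots> = - (\<Sum>x<n. J x) + \<gamma> / 2 * (\<Sum>x<n. M (P x) (P x) - M (P (Suc x)) (P (Suc x)))"
    by (simp only: sum.distrib sum_distrib_left sum_negf)
  finally show ?thesis using sum_lessThan_telescope'[of "\<lambda>x. M (P x) (P x)" n] by simp
qed

text \<open>Fluctuation-dissipation relation: the sum of the moment equations for \<open>r\<^sub>x\<^sub>+\<^sub>1 p\<^sub>x\<close> and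
  \<open>r\<^sub>x\<^sub>+\<^sub>1 p\<^sub>x\<^sub>+\<^sub>1\<close> expresses the current \<open>J\<close> as a discrete gradient.\<close>

lemma J_sum:
  "2 * \<gamma> * (\<Sum>x<n. J x) = M (P n) (P n) - M (P 0) (P 0) + \<tau> * m (R n)
    + (\<gamma> - \<gamma>b) / 2 * (J 0 + J (n - 1))"
proof -
  \<comment> \<open>The part shared, with opposite signs, by the equations for
    \<open>r_(x+1) p_x\<close> and \<open>r_(x+1) p_(x+1)\<close>; it cancels when they are added,
    and the remainder telescopes.\<close>
  define V where "V x = M (P x) (P (x - 1)) + M (R x) (R x)" for x
  have 1: "fr x * J x = V (Suc x) - M (P x) (P x) - M (R x) (R (Suc x))" if "x < n" for x
    using moment_eq[of "R (Suc x)" "P x"] that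
    by (simp add: noise_R drift_def V_def J_def M_commute[of "R _" "P _"] algebra_simps)
  have 2: "fr (Suc x) * J x = M (P (Suc x)) (P (Suc x)) + M (R (Suc (Suc x))) (R (Suc x)) - V (Suc x)"
    if "x < n" for x
    using moment_eq[of "R (Suc x)" "P (Suc x)"] that M_R_P[of "Suc x"]
    by (simp add: noise_R drift_def V_def J_def M_commute[of "R _" "P _"] M_commute[of "P x" "P (Suc x)"]
        algebra_simps)
  have "(\<Sum>x<n. (fr x + fr (Suc x)) * J x) =
      (\<Sum>x<n. M (P (Suc x)) (P (Suc x)) - M (P x) (P x)) +
      (\<Sum>x<n. M (R (Suc (Suc x))) (R (Suc x)) - M (R (Suc x)) (R x))"
    unfolding sum.distrib[symmetric]
    by (rule sum.cong) (auto simp: distrib_right 1 2 M_commute)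
  also have "\<dots> = M (P n) (P n) - M (P 0) (P 0) + (M (R (Suc n)) (R n) - M (R 1) (R 0))"
    using sum_lessThan_telescope[of "\<lambda>x. M (P x) (P x)" n]
      sum_lessThan_telescope[of "\<lambda>x. M (R (Suc x)) (R x)" n] by simp
  also have "M (R 1) (R 0) = 0" using M_left M_commute by metis
  finally have s: "(\<Sum>x<n. (fr x + fr (Suc x)) * J x) = M (P n) (P n) - M (P 0) (P 0) + \<tau> * m (R n)"
    by (simp add: M_right)
  \<comment> \<open>Two neighbouring frictions add up to \<open>2 * \<gamma>\<close> in the bulk.
    The first and the last bond each fall short by \<open>(\<gamma> - \<gamma>b) / 2\<close>; for
    \<open>n = 1\<close> both corrections hit the same bond.\<close>
  have "(fr x + fr (Suc x)) * J x = 2 * \<gamma> * J x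
      - (\<gamma> - \<gamma>b) / 2 * (of_bool (x = 0) * J x) - (\<gamma> - \<gamma>b) / 2 * (of_bool (x = n - 1) * J x)"
    if "x < n" for x
    using that by (auto simp: friction_def of_bool_def field_simps)
  hence "(\<Sum>x<n. (fr x + fr (Suc x)) * J x) = (\<Sum>x<n. 2 * \<gamma> * J x
      - (\<gamma> - \<gamma>b) / 2 * (of_bool (x = 0) * J x) - (\<gamma> - \<gamma>b) / 2 * (of_bool (x = n - 1) * J x))"
    by (intro sum.cong) auto
  also have "\<dots> = 2 * \<gamma> * (\<Sum>x<n. J x) - (\<gamma> - \<gamma>b) / 2 * (\<Sum>x<n. of_bool (x = 0) * J x)
      - (\<gamma> - \<gamma>b) / 2 * (\<Sum>x<n. of_bool (x = n - 1) * J x)"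
    by (simp only: sum_subtractf sum_distrib_left)
  also have "(\<Sum>x<n. of_bool (x = 0) * J x) = J 0"
    by (rule sum_of_bool_eq) (use n_pos in auto)
  also have "(\<Sum>x<n. of_bool (x = n - 1) * J x) = J (n - 1)"
    by (rule sum_of_bool_eq) (use n_pos in auto)
  finally show ?thesis using s by (simp only: distrib_left)
qed

section \<open>The covariance matrix and its dissipation\<close>

lemma C_commute: "C i k = C k i"
  using M_commute by (simp add: C_def)

text \<open>The fictitious elongations are deterministic. Passing from \<open>M\<close> to
  \<open>C\<close> thus removes the boundary terms from summation by parts.\<close>

lemma C_left: "C (R 0) i = 0" and C_right: "C (R (Suc n)) i = 0"
  by (simp_all add: C_def m_left m_right M_left M_right)

text \<open>The drift is linear and vanishes on the mean, so subtracting the product of the means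
  does not affect the drift terms. The noise keeps the full moments \<open>M\<close>.\<close>

lemma covariance_eq:
  assumes "i \<in> coords n" "k \<in> coords n"
  shows "drift \<gamma> \<gamma>b n i (\<lambda>l. C l k) + drift \<gamma> \<gamma>b n k (\<lambda>l. C l i) + noise \<gamma> \<gamma>b Tm Tp n M i k = 0"
proof -
  have "drift \<gamma> \<gamma>b n i' (\<lambda>l. C l k') = drift \<gamma> \<gamma>b n i' (\<lambda>l. M l k')" if "i' \<in> coords n" for i' k'
  proof -
    have "drift \<gamma> \<gamma>b n i' (\<lambda>l. C l k') =
        drift \<gamma> \<gamma>b n i' (\<lambda>l. M l k') - drift \<gamma> \<gamma>b n i' m * m k'"
      by (cases i') (auto simp: drift_def C_def algebra_simps)
    thus ?thesis using mean_eq[OF that] by simp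
  qed
  thus ?thesis using moment_eq[OF assms] assms by simp
qed

definition row where "row x = (\<Sum>k\<in>coords n. (C (P x) k)\<^sup>2)"

lemma drift_quadratic:
  assumes "v (R 0) = 0" "v (R (Suc n)) = 0"
  shows "(\<Sum>i\<in>coords n. v i * drift \<gamma> \<gamma>b n i v) = - (\<Sum>x\<le>n. fr x * (v (P x))\<^sup>2)"
  using sum_by_parts[of "\<lambda>x. v (R x)" "\<lambda>x. v (P x)" n] assms
  by (simp add: sum_coords drift_def right_diff_distrib sum_subtractf power2_eq_square mult_ac)

text \<open>A bond couples only its two momenta, so contraction with \<open>C\<close> picks four
  entries; the two off-diagonal ones agree by symmetry.\<close>

lemma noise_quadratic:
  "(\<Sum>i\<in>coords n. \<Sum>k\<in>coords n. C i k * noise \<gamma> \<gamma>b Tm Tp n M i k) =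
    \<gamma> * (\<Sum>x<n. C (P x) (P x) * M (P (Suc x)) (P (Suc x)) - 2 * C (P x) (P (Suc x)) * M (P x) (P (Suc x))
      + C (P (Suc x)) (P (Suc x)) * M (P x) (P x))
    + \<gamma>b * (Tm * C (P 0) (P 0) + Tp * C (P n) (P n))"
proof -
  have pick: "(\<Sum>i\<in>coords n. \<Sum>k\<in>coords n. C i k * (of_bool (i = a) * of_bool (k = b) * w)) = C a b * w"
    if "a \<in> coords n" "b \<in> coords n" for a b w
  proof -
    have "(\<Sum>i\<in>coords n. \<Sum>k\<in>coords n. C i k * (of_bool (i = a) * of_bool (k = b) * w)) =
        (\<Sum>i\<in>coords n. of_bool (i = a) * (\<Sum>k\<in>coords n. of_bool (k = b) * (C i k * w)))"
      by (simp add: sum_distrib_left mult_ac)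
    thus ?thesis using that by (simp add: sum_of_bool_eq)
  qed
  have p0: "P 0 \<in> coords n" and pn: "P n \<in> coords n" by auto
  have "(\<Sum>i\<in>coords n. \<Sum>k\<in>coords n. C i k * noise \<gamma> \<gamma>b Tm Tp n M i k) =
    \<gamma> * (\<Sum>i\<in>coords n. \<Sum>k\<in>coords n. \<Sum>x<n.
        C i k * (of_bool (i = P x) * of_bool (k = P x) * M (P (x + 1)) (P (x + 1)))
      - C i k * (of_bool (i = P x) * of_bool (k = P (x + 1)) * M (P (x + 1)) (P x))
      - C i k * (of_bool (i = P (x + 1)) * of_bool (k = P x) * M (P x) (P (x + 1)))
      + C i k * (of_bool (i = P (x + 1)) * of_bool (k = P (x + 1)) * M (P x) (P x)))
    + \<gamma>b * ((\<Sum>i\<in>coords n. \<Sum>k\<in>coords n. C i k * (of_bool (i = P 0) * of_bool (k = P 0) * Tm))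
      + (\<Sum>i\<in>coords n. \<Sum>k\<in>coords n. C i k * (of_bool (i = P n) * of_bool (k = P n) * Tp)))"
    unfolding noise_def sum_distrib_left sum.distrib[symmetric]
    by (intro sum.cong refl) (simp add: sum_distrib_left algebra_simps)
  also have "(\<Sum>i\<in>coords n. \<Sum>k\<in>coords n. \<Sum>x<n.
        C i k * (of_bool (i = P x) * of_bool (k = P x) * M (P (x + 1)) (P (x + 1)))
      - C i k * (of_bool (i = P x) * of_bool (k = P (x + 1)) * M (P (x + 1)) (P x))
      - C i k * (of_bool (i = P (x + 1)) * of_bool (k = P x) * M (P x) (P (x + 1)))
      + C i k * (of_bool (i = P (x + 1)) * of_bool (k = P (x + 1)) * M (P x) (P x))) =
     (\<Sum>x<n. \<Sum>i\<in>coords n. \<Sum>k\<in>coords n.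
        C i k * (of_bool (i = P x) * of_bool (k = P x) * M (P (x + 1)) (P (x + 1)))
      - C i k * (of_bool (i = P x) * of_bool (k = P (x + 1)) * M (P (x + 1)) (P x))
      - C i k * (of_bool (i = P (x + 1)) * of_bool (k = P x) * M (P x) (P (x + 1)))
      + C i k * (of_bool (i = P (x + 1)) * of_bool (k = P (x + 1)) * M (P x) (P x)))"
    by (rule sum_swap3)
  also have "\<dots> = (\<Sum>x<n. C (P x) (P x) * M (P (Suc x)) (P (Suc x)) - 2 * C (P x) (P (Suc x)) * M (P x) (P (Suc x))
      + C (P (Suc x)) (P (Suc x)) * M (P x) (P x))"
  proof (intro sum.cong refl)
    fix x assume "x \<in> {..<n}"
    hence x: "P x \<in> coords n" "P (x + 1) \<in> coords n" by auto
    show "(\<Sum>i\<in>coords n. \<Sum>k\<in>coords n.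
        C i k * (of_bool (i = P x) * of_bool (k = P x) * M (P (x + 1)) (P (x + 1)))
      - C i k * (of_bool (i = P x) * of_bool (k = P (x + 1)) * M (P (x + 1)) (P x))
      - C i k * (of_bool (i = P (x + 1)) * of_bool (k = P x) * M (P x) (P (x + 1)))
      + C i k * (of_bool (i = P (x + 1)) * of_bool (k = P (x + 1)) * M (P x) (P x))) =
      C (P x) (P x) * M (P (Suc x)) (P (Suc x)) - 2 * C (P x) (P (Suc x)) * M (P x) (P (Suc x))
      + C (P (Suc x)) (P (Suc x)) * M (P x) (P x)"
      using C_commute[of "P (Suc x)" "P x"] M_commute[of "P (Suc x)" "P x"]
      by (simp only: sum.distrib sum_subtractf pick x) simp
  qed
  finally show ?thesis
    unfolding pick[OF p0 p0] pick[OF pn pn] by (simp add: mult_ac)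
qed

text \<open>The stationary equation for the covariance matrix, tested against the covariance matrix itself:
  the antisymmetric part of the drift drops out.\<close>

lemma dissipation_identity:
  "\<gamma> * (\<Sum>x<n. row x + row (Suc x)) + \<gamma>b * (row 0 + row n) =
    \<gamma> * (\<Sum>x<n. C (P x) (P x) * M (P (Suc x)) (P (Suc x)) - 2 * C (P x) (P (Suc x)) * M (P x) (P (Suc x))
      + C (P (Suc x)) (P (Suc x)) * M (P x) (P x))
    + \<gamma>b * (Tm * C (P 0) (P 0) + Tp * C (P n) (P n))"
proof -
  have "0 = (\<Sum>i\<in>coords n. \<Sum>k\<in>coords n. C i k *
      (drift \<gamma> \<gamma>b n i (\<lambda>l. C l k) + drift \<gamma> \<gamma>b n k (\<lambda>l. C l i) + noise \<gamma> \<gamma>b Tm Tp n M i k))"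
    by (intro sum.neutral[symmetric] ballI) (simp add: covariance_eq)
  also have "\<dots> = (\<Sum>i\<in>coords n. \<Sum>k\<in>coords n. C i k * drift \<gamma> \<gamma>b n i (\<lambda>l. C l k))
      + (\<Sum>i\<in>coords n. \<Sum>k\<in>coords n. C i k * drift \<gamma> \<gamma>b n k (\<lambda>l. C l i))
      + (\<Sum>i\<in>coords n. \<Sum>k\<in>coords n. C i k * noise \<gamma> \<gamma>b Tm Tp n M i k)"
    by (simp add: distrib_left sum.distrib)
  \<comment> \<open>By symmetry of \<open>C\<close> both drift sums are the same quadratic form, to
    which \<open>drift_quadratic\<close> applies column by column.\<close>
  also have "(\<Sum>i\<in>coords n. \<Sum>k\<in>coords n. C i k * drift \<gamma> \<gamma>b n k (\<lambda>l. C l i)) =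
      (\<Sum>i\<in>coords n. \<Sum>k\<in>coords n. C k i * drift \<gamma> \<gamma>b n k (\<lambda>l. C l i))"
    using C_commute by (intro sum.cong refl) metis
  also have "\<dots> = - (\<Sum>x\<le>n. fr x * row x)"
    by (simp add: drift_quadratic C_left C_right row_def sum_distrib_left sum_negf)
       (subst sum.swap, simp add: C_commute[of _ "P _"])
  also have "(\<Sum>i\<in>coords n. \<Sum>k\<in>coords n. C i k * drift \<gamma> \<gamma>b n i (\<lambda>l. C l k)) = - (\<Sum>x\<le>n. fr x * row x)"
    by (subst sum.swap)
       (simp add: drift_quadratic C_left C_right row_def sum_distrib_left sum_negf,
        subst sum.swap, simp add: C_commute[of _ "P _"])
  finally have "2 * (\<Sum>x\<le>n. fr x * row x) = (\<Sum>i\<in>coords n. \<Sum>k\<in>coords n. C i k * noise \<gamma> \<gamma>b Tm Tp n M i k)"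
    by linarith
  \<comment> \<open>Twice the friction at a site is \<open>\<gamma>\<close> per adjacent bond plus
    \<open>\<gamma>b\<close> per thermostat, so the sum over sites becomes a sum over bonds.\<close>
  moreover have "2 * (\<Sum>x\<le>n. fr x * row x) = \<gamma> * (\<Sum>x<n. row x + row (Suc x)) + \<gamma>b * (row 0 + row n)"
  proof -
    have "2 * (\<Sum>x\<le>n. fr x * row x) = \<gamma> * ((\<Sum>x\<le>n. of_bool (0 < x) * row x) + (\<Sum>x\<le>n. of_bool (x < n) * row x))
       + \<gamma>b * ((\<Sum>x\<le>n. of_bool (x = 0) * row x) + (\<Sum>x\<le>n. of_bool (x = n) * row x))"
      unfolding sum_distrib_left sum.distrib[symmetric]
      by (intro sum.cong) (auto simp: friction_def algebra_simps)
    also have "(\<Sum>x\<le>n. of_bool (x < n) * row x) = (\<Sum>x<n. row x)"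
      by (rule sum.mono_neutral_cong_right) auto
    also have "(\<Sum>x\<le>n. of_bool (0 < x) * row x) = (\<Sum>x<n. row (Suc x))"
      by (subst sum.atMost_shift) simp
    finally show ?thesis by (simp add: sum_of_bool_eq sum.distrib)
  qed
  ultimately show ?thesis using noise_quadratic by simp
qed

lemma row_ge:
  assumes "i \<in> coords n" "k \<in> coords n" "i \<noteq> k"
  shows "(C (P x) i)\<^sup>2 + (C (P x) k)\<^sup>2 \<le> row x"
proof -
  have "sum (\<lambda>k. (C (P x) k)\<^sup>2) {i, k} \<le> row x"
    unfolding row_def by (rule sum_mono2) (use assms in auto)
  thus ?thesis using assms by simp
qed

text \<open>In \<open>dissipation_identity\<close> each row is bounded below by two of its squared
  entries. In the bulk these are absorbed by the noise term, which leaves squared gradients of the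
  variances with a favourable sign; at the thermostats the squared boundary covariances are left
  over. The gradients pay for the contribution of the nonzero mean momentum.\<close>

lemma boundary_covariance_bound:
  "\<gamma>b * ((C (P 0) (R 1))\<^sup>2 + (C (P n) (R n))\<^sup>2) \<le>
    \<gamma>b * (C (P 0) (P 0) * (Tm - C (P 0) (P 0)) + C (P n) (P n) * (Tp - C (P n) (P n)))
    + 2 * \<gamma> * (real n * pbar\<^sup>2 * \<bar>C (P 0) (P 0)\<bar> + real n * (real n * pbar\<^sup>2)\<^sup>2)"
proof -
  define c where "c x = C (P x) (P x)" for x
  define k where "k x = C (P x) (P (Suc x))" for x
  define a where "a = real n * pbar\<^sup>2"
  have a0: "a \<ge> 0" by (simp add: a_def)
  have MC: "M (P x) (P y) = C (P x) (P y) + pbar\<^sup>2" if "x \<le> n" "y \<le> n" for x y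
    using m_P that by (simp add: C_def power2_eq_square)
  have r0: "(c 0)\<^sup>2 + (C (P 0) (R 1))\<^sup>2 \<le> row 0"
    unfolding c_def using n_pos by (intro row_ge) auto
  have rn: "(c n)\<^sup>2 + (C (P n) (R n))\<^sup>2 \<le> row n"
    unfolding c_def using n_pos by (intro row_ge) auto
  have rx: "(c x)\<^sup>2 + (k x)\<^sup>2 + (c (Suc x))\<^sup>2 + (k x)\<^sup>2 \<le> row x + row (Suc x)" if "x < n" for x
  proof -
    have "(c x)\<^sup>2 + (k x)\<^sup>2 \<le> row x"
      unfolding c_def k_def using that by (intro row_ge) auto
    moreover have "(c (Suc x))\<^sup>2 + (k x)\<^sup>2 \<le> row (Suc x)"
      unfolding c_def k_def C_commute[of "P x"] using that by (intro row_ge) auto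
    ultimately show ?thesis by linarith
  qed
  have "(\<Sum>x<n. (c x)\<^sup>2 + (k x)\<^sup>2 + (c (Suc x))\<^sup>2 + (k x)\<^sup>2) \<le> (\<Sum>x<n. row x + row (Suc x))"
    by (intro sum_mono rx) auto
  hence 1: "\<gamma> * (\<Sum>x<n. (c x)\<^sup>2 + (k x)\<^sup>2 + (c (Suc x))\<^sup>2 + (k x)\<^sup>2) \<le> \<gamma> * (\<Sum>x<n. row x + row (Suc x))"
    using \<gamma>_pos by (intro mult_left_mono) auto
  have 2: "\<gamma>b * ((c 0)\<^sup>2 + (C (P 0) (R 1))\<^sup>2 + ((c n)\<^sup>2 + (C (P n) (R n))\<^sup>2)) \<le> \<gamma>b * (row 0 + row n)"
    using \<gamma>b_pos r0 rn by (intro mult_left_mono add_mono) auto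
  \<comment> \<open>Writes \<open>2 * c x * c (Suc x) - 2 * (k x)^2\<close> as the squares
    controlled by the rows minus a nonnegative remainder; the terms with \<open>pbar\<close> come
    from \<open>M = C + pbar^2\<close>.\<close>
  have "C (P x) (P x) * M (P (Suc x)) (P (Suc x)) - 2 * C (P x) (P (Suc x)) * M (P x) (P (Suc x))
      + C (P (Suc x)) (P (Suc x)) * M (P x) (P x) =
      ((c x)\<^sup>2 + (k x)\<^sup>2 + (c (Suc x))\<^sup>2 + (k x)\<^sup>2) - ((c x - c (Suc x))\<^sup>2 + 4 * (k x)\<^sup>2)
      + pbar\<^sup>2 * (c x + c (Suc x) - 2 * k x)" if "x < n" for x
    using that by (simp add: MC c_def k_def power2_eq_square algebra_simps)
  hence "(\<Sum>x<n. C (P x) (P x) * M (P (Suc x)) (P (Suc x)) - 2 * C (P x) (P (Suc x)) * M (P x) (P (Suc x))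
      + C (P (Suc x)) (P (Suc x)) * M (P x) (P x)) =
      (\<Sum>x<n. ((c x)\<^sup>2 + (k x)\<^sup>2 + (c (Suc x))\<^sup>2 + (k x)\<^sup>2) - ((c x - c (Suc x))\<^sup>2 + 4 * (k x)\<^sup>2)
      + pbar\<^sup>2 * (c x + c (Suc x) - 2 * k x))" by (intro sum.cong) auto
  also have "\<dots> = (\<Sum>x<n. (c x)\<^sup>2 + (k x)\<^sup>2 + (c (Suc x))\<^sup>2 + (k x)\<^sup>2)
      - (\<Sum>x<n. (c x - c (Suc x))\<^sup>2 + 4 * (k x)\<^sup>2) + (\<Sum>x<n. pbar\<^sup>2 * (c x + c (Suc x) - 2 * k x))"
    by (simp only: sum.distrib sum_subtractf)
  \<comment> \<open>Every variance is at most \<open>\<bar>c 0\<bar>\<close> plus the total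
    variation \<open>D\<close>. Summing over \<open>n\<close> bonds produces the weight
    \<open>a\<close>, and Young's inequality absorbs \<open>D\<close> and the \<open>k x\<close>
    into the remainder at cost \<open>2 * a^2\<close> per bond.\<close>
  also have "(\<Sum>x<n. pbar\<^sup>2 * (c x + c (Suc x) - 2 * k x)) \<le>
      2 * a * \<bar>c 0\<bar> + (\<Sum>x<n. (c x - c (Suc x))\<^sup>2 + 4 * (k x)\<^sup>2) + 2 * (real n * a\<^sup>2)"
  proof -
    define D where "D = (\<Sum>x<n. \<bar>c x - c (Suc x)\<bar>)"
    have "c x + c (Suc x) - 2 * k x \<le> 2 * (\<bar>c 0\<bar> + D) + 2 * \<bar>k x\<bar>" if "x < n" for x
    proof -
      have "\<bar>c x\<bar> \<le> \<bar>c 0\<bar> + D" "\<bar>c (Suc x)\<bar> \<le> \<bar>c 0\<bar> + D"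
        using that unfolding D_def by (intro abs_le_initial_plus_variation; simp)+
      hence "c x \<le> \<bar>c 0\<bar> + D" "c (Suc x) \<le> \<bar>c 0\<bar> + D" by (auto dest: abs_le_D1)
      moreover have "u + v - 2 * w \<le> 2 * A + 2 * \<bar>w\<bar>" if "u \<le> A" "v \<le> A" for u v w A :: real
        using that by linarith
      ultimately show ?thesis by blast
    qed
    hence "(\<Sum>x<n. pbar\<^sup>2 * (c x + c (Suc x) - 2 * k x)) \<le> (\<Sum>x<n. pbar\<^sup>2 * (2 * (\<bar>c 0\<bar> + D) + 2 * \<bar>k x\<bar>))"
      by (intro sum_mono mult_left_mono) auto
    also have "\<dots> = 2 * a * \<bar>c 0\<bar> + 2 * a * D + (\<Sum>x<n. 2 * pbar\<^sup>2 * \<bar>k x\<bar>)"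
      by (simp add: sum.distrib sum_distrib_left a_def algebra_simps)
    also have "(\<Sum>x<n. 2 * pbar\<^sup>2 * \<bar>k x\<bar>) \<le> (\<Sum>x<n. 2 * a * \<bar>k x\<bar>)"
    proof (intro sum_mono mult_right_mono mult_left_mono)
      show "pbar\<^sup>2 \<le> a" unfolding a_def using n_pos mult_right_mono[of 1 "real n" "pbar\<^sup>2"] by simp
    qed auto
    also have "2 * a * \<bar>c 0\<bar> + 2 * a * D + (\<Sum>x<n. 2 * a * \<bar>k x\<bar>) =
        2 * a * \<bar>c 0\<bar> + (\<Sum>x<n. 2 * a * \<bar>c x - c (Suc x)\<bar> + 2 * a * \<bar>k x\<bar>)"
      by (simp add: D_def sum.distrib sum_distrib_left)
    also have "(\<Sum>x<n. 2 * a * \<bar>c x - c (Suc x)\<bar> + 2 * a * \<bar>k x\<bar>) \<le>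
        (\<Sum>x<n. ((c x - c (Suc x))\<^sup>2 + 4 * (k x)\<^sup>2) + 2 * a\<^sup>2)"
    proof (intro sum_mono)
      fix x
      have "2 * a * \<bar>c x - c (Suc x)\<bar> \<le> (c x - c (Suc x))\<^sup>2 + a\<^sup>2"
        using zero_le_power2[of "\<bar>c x - c (Suc x)\<bar> - a"] by (simp add: power2_eq_square algebra_simps)
      moreover have "2 * a * \<bar>k x\<bar> \<le> (k x)\<^sup>2 + a\<^sup>2"
        using zero_le_power2[of "\<bar>k x\<bar> - a"] by (simp add: power2_eq_square algebra_simps)
      ultimately show "2 * a * \<bar>c x - c (Suc x)\<bar> + 2 * a * \<bar>k x\<bar> \<le>
          ((c x - c (Suc x))\<^sup>2 + 4 * (k x)\<^sup>2) + 2 * a\<^sup>2"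
        using zero_le_power2[of "k x"] by linarith
    qed
    also have "\<dots> = (\<Sum>x<n. (c x - c (Suc x))\<^sup>2 + 4 * (k x)\<^sup>2) + 2 * (real n * a\<^sup>2)"
      by (simp add: sum.distrib)
    finally show ?thesis by simp
  qed
  finally have 3: "(\<Sum>x<n. C (P x) (P x) * M (P (Suc x)) (P (Suc x)) - 2 * C (P x) (P (Suc x)) * M (P x) (P (Suc x))
      + C (P (Suc x)) (P (Suc x)) * M (P x) (P x)) \<le>
      (\<Sum>x<n. (c x)\<^sup>2 + (k x)\<^sup>2 + (c (Suc x))\<^sup>2 + (k x)\<^sup>2) + 2 * a * \<bar>c 0\<bar> + 2 * (real n * a\<^sup>2)"
    by simp
  have "\<gamma> * (\<Sum>x<n. C (P x) (P x) * M (P (Suc x)) (P (Suc x)) - 2 * C (P x) (P (Suc x)) * M (P x) (P (Suc x))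
      + C (P (Suc x)) (P (Suc x)) * M (P x) (P x)) \<le>
      \<gamma> * (\<Sum>x<n. (c x)\<^sup>2 + (k x)\<^sup>2 + (c (Suc x))\<^sup>2 + (k x)\<^sup>2)
      + \<gamma> * (2 * a * \<bar>c 0\<bar> + 2 * (real n * a\<^sup>2))"
    using mult_left_mono[OF 3, of \<gamma>] \<gamma>_pos by (simp only: distrib_left add.assoc less_imp_le)
  with 1 2 dissipation_identity
  have "\<gamma>b * ((c 0)\<^sup>2 + (C (P 0) (R 1))\<^sup>2 + ((c n)\<^sup>2 + (C (P n) (R n))\<^sup>2)) \<le>
      \<gamma> * (2 * a * \<bar>c 0\<bar> + 2 * (real n * a\<^sup>2)) + \<gamma>b * (Tm * C (P 0) (P 0) + Tp * C (P n) (P n))"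
    by linarith
  thus ?thesis
    by (simp add: a_def c_def power2_eq_square algebra_simps)
qed

section \<open>The current in terms of boundary data\<close>

lemma C_P_0: "C (P 0) (P 0) = Tm - 2 * j / \<gamma>b - pbar\<^sup>2"
  using \<gamma>b_pos by (simp add: C_def j_def pbar_def power2_eq_square field_simps)

lemma C_P_n: "C (P n) (P n) = Tp + 2 * (j + \<tau> * pbar) / \<gamma>b - pbar\<^sup>2"
proof -
  have "C (P n) (P n) = M (P n) (P n) - pbar\<^sup>2" by (simp add: C_def m_P power2_eq_square)
  moreover have "M (P n) (P n) = Tp + 2 * (j + \<tau> * pbar) / \<gamma>b"
    using \<gamma>b_pos right_current by (simp add: field_simps)
  ultimately show ?thesis by simp
qed

text \<open>Inserts \<open>J_sum\<close> into \<open>current_sum\<close>. In the coefficient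
  \<open>1 + \<gamma>\<^sup>2\<close> the 1 comes from the Hamiltonian current and
  \<open>\<gamma>\<^sup>2\<close> from the stochastic exchange of kinetic energy.\<close>

lemma current_identity:
  "2 * \<gamma> * (real n * j) = - (1 + \<gamma>\<^sup>2) * (Tp - Tm + (4 * j + 2 * \<tau> * pbar) / \<gamma>b)
    - \<tau> * (\<tau> - (\<gamma> + \<gamma>b) / 2 * pbar)
    - (\<gamma> - \<gamma>b) / 2 * (C (P 0) (R 1) + C (P n) (R n) + \<tau> * pbar)"
proof -
  define Z where "Z = (4 * j + 2 * \<tau> * pbar) / \<gamma>b"
  have "J 0 = C (P 0) (R 1) + pbar * m (R 1)" by (simp add: J_def C_def pbar_def)
  moreover have "J (n - 1) = C (P n) (R n) + pbar * m (R n)"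
    using M_R_P[of n] n_pos by (simp add: J_def C_def m_P)
  ultimately have bdry: "J 0 + J (n - 1) = C (P 0) (R 1) + C (P n) (R n) + \<tau> * pbar"
    unfolding m_R_1 m_R_n by (simp add: algebra_simps)
  have "M (P 0) (P 0) = Tm - 2 * j / \<gamma>b"
    using \<gamma>b_pos by (simp add: j_def field_simps)
  moreover have "M (P n) (P n) = Tp + 2 * (j + \<tau> * pbar) / \<gamma>b"
    using \<gamma>b_pos right_current by (simp add: field_simps)
  ultimately have M: "M (P 0) (P 0) - M (P n) (P n) = - (Tp - Tm + (4 * j + 2 * \<tau> * pbar) / \<gamma>b)"
    by (simp add: add_divide_distrib)
  have J: "2 * \<gamma> * (\<Sum>x<n. J x) = Tp - Tm + (4 * j + 2 * \<tau> * pbar) / \<gamma>b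
      + \<tau> * (\<tau> - (\<gamma> + \<gamma>b) / 2 * pbar) + (\<gamma> - \<gamma>b) / 2 * (C (P 0) (R 1) + C (P n) (R n) + \<tau> * pbar)"
    using J_sum M unfolding m_R_n bdry by linarith
  have "2 * \<gamma> * (real n * j) = - (2 * \<gamma> * (\<Sum>x<n. J x)) + \<gamma>\<^sup>2 * (M (P 0) (P 0) - M (P n) (P n))"
    unfolding current_sum by (simp add: power2_eq_square algebra_simps)
  also have "\<dots> = - (Tp - Tm + Z + \<tau> * (\<tau> - (\<gamma> + \<gamma>b) / 2 * pbar)
      + (\<gamma> - \<gamma>b) / 2 * (C (P 0) (R 1) + C (P n) (R n) + \<tau> * pbar)) - \<gamma>\<^sup>2 * (Tp - Tm + Z)"
    unfolding J M Z_def by (simp only: mult_minus_right add_uminus_conv_diff)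
  finally show ?thesis unfolding Z_def[symmetric] by (simp add: algebra_simps)
qed

end

section \<open>The limit of the current\<close>

text \<open>Reduces the rest to real sequences: \<open>p\<close> is the mean momentum,
  \<open>u\<close> and \<open>v\<close> are the covariances of \<open>(p_0, r_1)\<close> and
  \<open>(p_n, r_n)\<close>, and \<open>c\<close> and \<open>d\<close> the variances of
  \<open>p_0\<close> and \<open>p_n\<close>.\<close>

lemma stationary_current_characterization:
  fixes \<gamma> \<gamma>b Tm Tp \<tau> :: real and \<mu> :: "config measure" and n :: nat
  assumes \<gamma>: "\<gamma> > 0" and \<gamma>b: "\<gamma>b > 0" and n: "n \<ge> 1"
    and K: "markov_semigroup (Omega n) K"
    and gen: "has_generator n K (generator \<gamma> \<gamma>b Tm Tp \<tau> n)"
    and st: "stationary (Omega n) K \<mu>"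
    and int: "\<And>i. i \<in> coords n \<Longrightarrow> integrable \<mu> (\<lambda>\<xi>. (\<xi> i)\<^sup>2)"
  defines "j \<equiv> stationary_current \<gamma> \<gamma>b Tm Tp \<tau> n \<mu>"
  shows "\<exists>p u v c d. (real n * \<gamma> + \<gamma>b) * p = \<tau>
    \<and> c = Tm - 2 * j / \<gamma>b - p\<^sup>2 \<and> d = Tp + 2 * (j + \<tau> * p) / \<gamma>b - p\<^sup>2
    \<and> \<gamma>b * (u\<^sup>2 + v\<^sup>2) \<le> \<gamma>b * (c * (Tm - c) + d * (Tp - d))
        + 2 * \<gamma> * (real n * p\<^sup>2 * \<bar>c\<bar> + real n * (real n * p\<^sup>2)\<^sup>2)
    \<and> 2 * \<gamma> * (real n * j) = - (1 + \<gamma>\<^sup>2) * (Tp - Tm + (4 * j + 2 * \<tau> * p) / \<gamma>b)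
        - \<tau> * (\<tau> - (\<gamma> + \<gamma>b) / 2 * p) - (\<gamma> - \<gamma>b) / 2 * (u + v + \<tau> * p)"
proof -
  define m where "m = (\<lambda>i. \<integral>\<xi>. ext \<tau> n \<xi> i \<partial>\<mu>)"
  define M where "M = (\<lambda>i k. \<integral>\<xi>. ext \<tau> n \<xi> i * ext \<tau> n \<xi> k \<partial>\<mu>)"
  have "prob_space \<mu>" using st by (auto simp: stationary_def space_prob_algebra)
  then interpret \<mu>: prob_space \<mu> .
  note eqs = stationary_moment_equations[OF n K gen st int]
  interpret s: moment_system \<gamma> \<gamma>b Tm Tp \<tau> n m M
  proof
    show "M i k = M k i" for i k by (simp add: M_def mult.commute)
    show "m (R 0) = 0" "m (R (Suc n)) = \<tau>"
      by (simp_all add: m_def ext_def \<mu>.prob_space)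
    show "M (R 0) i = 0" "M (R (Suc n)) i = \<tau> * m i" for i
      by (simp_all add: m_def M_def ext_def[of _ _ _ "R _"])
    show "drift \<gamma> \<gamma>b n i m = 0" if "i \<in> coords n" for i
      using eqs(3)[of i] that by (simp add: m_def)
    show "drift \<gamma> \<gamma>b n i (\<lambda>k. M k l) + drift \<gamma> \<gamma>b n l (\<lambda>k. M k i) + noise \<gamma> \<gamma>b Tm Tp n M i l = 0"
      if "i \<in> coords n" "l \<in> coords n" for i l
      using eqs(4)[of i l] that by (simp add: M_def)
  qed (use \<gamma> \<gamma>b n in auto)
  have int1: "integrable \<mu> (\<lambda>\<xi>. \<xi> i)" and m: "(\<integral>\<xi>. \<xi> i \<partial>\<mu>) = m i" if "i \<in> coords n" for i
    using eqs(1)[of i] that by (simp_all add: ext_def m_def)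
  have int2: "integrable \<mu> (\<lambda>\<xi>. \<xi> i * \<xi> k)" and M: "(\<integral>\<xi>. \<xi> i * \<xi> k \<partial>\<mu>) = M i k"
    if "i \<in> coords n" "k \<in> coords n" for i k
    using eqs(2)[of i k] that by (simp_all add: ext_def M_def)
  have cur: "(\<integral>\<xi>. current \<gamma> \<gamma>b Tm Tp \<tau> n x \<xi> \<partial>\<mu>) = s.j" if x: "x \<in> {-1..int n}" for x
  proof -
    consider "x = -1" | "x = int n" | y where "x = int y" "y < n"
    proof (cases "x < 0")
      case True
      thus thesis using x that(1) by auto
    next
      case False
      then obtain y where "x = int y" using nonneg_int_cases[of x] by auto
      thus thesis using x that(2,3) by fastforce
    qed
    thus ?thesis
    proof cases
      case 1
      thus ?thesis using int2[of "P 0" "P 0"] M[of "P 0" "P 0"]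
        by (simp add: current_def power2_eq_square s.j_def \<mu>.prob_space)
    next
      case 2
      thus ?thesis
        using int2[of "P n" "P n"] M[of "P n" "P n"] int1[of "P n"] m[of "P n"] s.right_current s.m_P[of n]
        by (simp add: current_def power2_eq_square \<mu>.prob_space)
    next
      case (3 y)
      hence "current \<gamma> \<gamma>b Tm Tp \<tau> n x = (\<lambda>\<xi>. - (\<xi> (P y) * \<xi> (R (y + 1)))
          + \<gamma> / 2 * (\<xi> (P y) * \<xi> (P y) - \<xi> (P (y + 1)) * \<xi> (P (y + 1))))"
        by (auto simp: current_def power2_eq_square fun_eq_iff)
      thus ?thesis
        using 3 int2 M s.bulk_current[of y] by simp
    qed
  qed
  \<comment> \<open>Equality of all averages gives existence for the definite description, and the
    single position \<open>-1\<close> gives uniqueness.\<close>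
  have "stationary_current \<gamma> \<gamma>b Tm Tp \<tau> n \<mu> = s.j"
    unfolding stationary_current_def
  proof (rule the_equality)
    show "\<forall>x\<in>{- 1..int n}. (\<integral>\<xi>. current \<gamma> \<gamma>b Tm Tp \<tau> n x \<xi> \<partial>\<mu>) = s.j"
      using cur by blast
    show "j' = s.j" if "\<forall>x\<in>{- 1..int n}. (\<integral>\<xi>. current \<gamma> \<gamma>b Tm Tp \<tau> n x \<xi> \<partial>\<mu>) = j'" for j'
      using that cur[of "-1"] by auto
  qed
  hence j: "j = s.j" by (simp add: j_def)
  show ?thesis
    unfolding j
    using s.pbar_eq s.C_P_0 s.C_P_n s.boundary_covariance_bound s.current_identity by blast
qed

section \<open>Asymptotics for large chains\<close>

text \<open>For large \<open>n\<close> the term \<open>B * \<bar>j n\<bar>\<close> is at most half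
  of the left side, which leaves \<open>\<bar>j n\<bar> \<le> 2 * A / (k * n)\<close>.\<close>

lemma tendsto_of_self_bound:
  fixes j :: "nat \<Rightarrow> real"
  assumes k: "k > 0" and b: "\<forall>\<^sub>F n in sequentially. \<bar>k * (real n * j n)\<bar> \<le> A + B * \<bar>j n\<bar>"
  shows "j \<longlonglongrightarrow> 0"
proof (rule Lim_null_comparison)
  have "\<forall>\<^sub>F n in sequentially. \<bar>B\<bar> \<le> k / 2 * real n" and "\<forall>\<^sub>F n in sequentially. 0 < real n"
    using k by real_asymp+
  with b show "\<forall>\<^sub>F n in sequentially. norm (j n) \<le> 2 * A / k * (1 / real n)"
  proof eventually_elim
    case (elim n)
    have "B * \<bar>j n\<bar> \<le> k / 2 * real n * \<bar>j n\<bar>"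
      using elim by (intro mult_right_mono) auto
    hence "k * (real n * \<bar>j n\<bar>) \<le> 2 * A"
      using elim(1) k by (simp add: abs_mult)
    thus ?case using k elim(3) by (simp add: field_simps)
  qed
  show "(\<lambda>n. 2 * A / k * (1 / real n)) \<longlonglongrightarrow> 0" by real_asymp
qed

text \<open>Completing the square. The variances \<open>c\<close> and \<open>d\<close> depend on the
  current, and this bound keeps their quadratic terms from entering the estimate for it.\<close>

lemma mult_diff_le_quarter_square: "c * (T - c) \<le> T\<^sup>2 / (4 :: real)"
  using zero_le_power2[of "T / 2 - c"] by (simp add: power2_eq_square algebra_simps)

lemma current_limit:
  fixes j p u v c d :: "nat \<Rightarrow> real"
  assumes \<gamma>: "\<gamma> > 0" and \<gamma>b: "\<gamma>b > 0"
    and p: "\<And>n. n \<ge> 1 \<Longrightarrow> (real n * \<gamma> + \<gamma>b) * p n = \<tau>"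
    and c: "\<And>n. n \<ge> 1 \<Longrightarrow> c n = Tm - 2 * j n / \<gamma>b - (p n)\<^sup>2"
    and d: "\<And>n. n \<ge> 1 \<Longrightarrow> d n = Tp + 2 * (j n + \<tau> * p n) / \<gamma>b - (p n)\<^sup>2"
    and bound: "\<And>n. n \<ge> 1 \<Longrightarrow> \<gamma>b * ((u n)\<^sup>2 + (v n)\<^sup>2) \<le>
        \<gamma>b * (c n * (Tm - c n) + d n * (Tp - d n))
        + 2 * \<gamma> * (real n * (p n)\<^sup>2 * \<bar>c n\<bar> + real n * (real n * (p n)\<^sup>2)\<^sup>2)"
    and ident: "\<And>n. n \<ge> 1 \<Longrightarrow>
        2 * \<gamma> * (real n * j n) = - (1 + \<gamma>\<^sup>2) * (Tp - Tm + (4 * j n + 2 * \<tau> * p n) / \<gamma>b)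
        - \<tau> * (\<tau> - (\<gamma> + \<gamma>b) / 2 * p n) - (\<gamma> - \<gamma>b) / 2 * (u n + v n + \<tau> * p n)"
  shows "(\<lambda>n. real n * j n) \<longlonglongrightarrow> - (1 / 2) * (1 / \<gamma> + \<gamma>) * (Tp - Tm) - \<tau>\<^sup>2 / (2 * \<gamma>)"
proof -
  have ge1: "\<forall>\<^sub>F n in sequentially. n \<ge> (1 :: nat)" by (rule eventually_ge_at_top)
  have p_eq: "p n = \<tau> / (real n * \<gamma> + \<gamma>b)" if "n \<ge> 1" for n
  proof -
    have "real n * \<gamma> + \<gamma>b > 0" using \<gamma> \<gamma>b by (simp add: add_nonneg_pos)
    thus ?thesis using p[OF that] by (simp add: field_simps)
  qed
  \<comment> \<open>Splits off \<open>\<tau>\<close>, so that the decay rates are those of an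
    explicit positive function of \<open>n\<close>.\<close>
  define r where "r = (\<lambda>n. 1 / (real n * \<gamma> + \<gamma>b))"
  have p_ev: "\<forall>\<^sub>F n in sequentially. p n = \<tau> * r n"
    using ge1 by eventually_elim (simp add: p_eq r_def)
  have r0: "r \<longlonglongrightarrow> 0"
    and r1: "(\<lambda>n. real n * (r n)\<^sup>2) \<longlonglongrightarrow> 0"
    and r2: "(\<lambda>n. real n * (real n * (r n)\<^sup>2)\<^sup>2) \<longlonglongrightarrow> 0"
    unfolding r_def using \<gamma> \<gamma>b by real_asymp+
  have p0: "p \<longlonglongrightarrow> 0"
    using tendsto_mult_right_zero[OF r0, of \<tau>] tendsto_cong[OF p_ev] by blast
  have a0: "(\<lambda>n. real n * (p n)\<^sup>2) \<longlonglongrightarrow> 0"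
  proof (rule Lim_transform_eventually[OF tendsto_mult_right_zero[OF r1, of "\<tau>\<^sup>2"]])
    show "\<forall>\<^sub>F n in sequentially. \<tau>\<^sup>2 * (real n * (r n)\<^sup>2) = real n * (p n)\<^sup>2"
      using p_ev by eventually_elim (simp add: power_mult_distrib)
  qed
  have b0: "(\<lambda>n. real n * (real n * (p n)\<^sup>2)\<^sup>2) \<longlonglongrightarrow> 0"
  proof (rule Lim_transform_eventually[OF tendsto_mult_right_zero[OF r2, of "\<tau> ^ 4"]])
    show "\<forall>\<^sub>F n in sequentially.
        \<tau> ^ 4 * (real n * (real n * (r n)\<^sup>2)\<^sup>2) = real n * (real n * (p n)\<^sup>2)\<^sup>2"
      using p_ev by eventually_elim (simp add: power_mult_distrib)
  qed
  have uv_le: "(u n)\<^sup>2 + (v n)\<^sup>2 \<le> c n * (Tm - c n) + d n * (Tp - d n)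
        + 2 * \<gamma> / \<gamma>b * (real n * (p n)\<^sup>2 * \<bar>c n\<bar> + real n * (real n * (p n)\<^sup>2)\<^sup>2)" if "n \<ge> 1" for n
    using bound[OF that] \<gamma>b by (simp add: field_simps)
  have le1: "\<forall>\<^sub>F n in sequentially. \<bar>f n\<bar> \<le> 1" if "f \<longlonglongrightarrow> 0" for f :: "nat \<Rightarrow> real"
    using order_tendstoD(2)[OF tendsto_rabs[OF that], of 1] by (auto elim: eventually_mono)
  define W where "W = 1 + (Tm\<^sup>2 / 4 + Tp\<^sup>2 / 4 + 2 * \<gamma> / \<gamma>b * (\<bar>Tm\<bar> + 1 + 1))"
  have j0: "j \<longlonglongrightarrow> 0"
  proof (rule tendsto_of_self_bound[where k = "2 * \<gamma>"])
    show "\<forall>\<^sub>F n in sequentially. \<bar>2 * \<gamma> * (real n * j n)\<bar> \<le>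
      ((1 + \<gamma>\<^sup>2) * (\<bar>Tp - Tm\<bar> + 2 * \<bar>\<tau>\<bar> / \<gamma>b) + \<bar>\<tau>\<bar> * (\<bar>\<tau>\<bar> + (\<gamma> + \<gamma>b) / 2) + \<bar>\<gamma> - \<gamma>b\<bar> / 2 * (W + \<bar>\<tau>\<bar>))
      + ((1 + \<gamma>\<^sup>2) * (4 / \<gamma>b) + \<bar>\<gamma> - \<gamma>b\<bar> / 2 * (2 * \<gamma> / \<gamma>b * (2 / \<gamma>b))) * \<bar>j n\<bar>"
      using ge1 le1[OF p0] le1[OF a0] le1[OF b0]
    proof eventually_elim
      case (elim n)
      define q where "q = \<bar>j n\<bar>"
      have pp: "(p n)\<^sup>2 \<le> 1" using elim(2) by (simp add: abs_square_le_1)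
      have "\<bar>c n\<bar> \<le> \<bar>Tm\<bar> + \<bar>2 * j n / \<gamma>b\<bar> + \<bar>(p n)\<^sup>2\<bar>"
        unfolding c[OF elim(1)] by linarith
      hence c_le: "\<bar>c n\<bar> \<le> \<bar>Tm\<bar> + 1 + 2 / \<gamma>b * q"
        using pp \<gamma>b by (simp add: abs_mult q_def)
      have "real n * (p n)\<^sup>2 * \<bar>c n\<bar> \<le> 1 * \<bar>c n\<bar>"
        using elim(3) by (intro mult_right_mono) auto
      hence "real n * (p n)\<^sup>2 * \<bar>c n\<bar> + real n * (real n * (p n)\<^sup>2)\<^sup>2 \<le> \<bar>Tm\<bar> + 1 + 1 + 2 / \<gamma>b * q"
        using c_le elim(4) by linarith
      from mult_left_mono[OF this, of "2 * \<gamma> / \<gamma>b"] \<gamma> \<gamma>b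
      have "2 * \<gamma> / \<gamma>b * (real n * (p n)\<^sup>2 * \<bar>c n\<bar> + real n * (real n * (p n)\<^sup>2)\<^sup>2) \<le>
          2 * \<gamma> / \<gamma>b * (\<bar>Tm\<bar> + 1 + 1) + 2 * \<gamma> / \<gamma>b * (2 / \<gamma>b) * q"
        by (simp only: distrib_left mult.assoc) simp
      \<comment> \<open>Only \<open>\<bar>c n\<bar>\<close> brings in the current, so the bound on
        the squared covariances is linear in \<open>q\<close>. The summand 1 in \<open>W\<close>
        serves the passage from squares to \<open>\<bar>u n + v n\<bar>\<close> below.\<close>
      with uv_le[OF elim(1)] mult_diff_le_quarter_square[of "c n" Tm] mult_diff_le_quarter_square[of "d n" Tp]
      have uv: "(u n)\<^sup>2 + (v n)\<^sup>2 + 1 \<le> W + 2 * \<gamma> / \<gamma>b * (2 / \<gamma>b) * q"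
        unfolding W_def by linarith
      have "2 * \<bar>x\<bar> \<le> x\<^sup>2 + 1" for x :: real
        using zero_le_power2[of "\<bar>x\<bar> - 1"] by (simp add: power2_eq_square algebra_simps)
      from this[of "u n"] this[of "v n"] uv
      have uv1: "\<bar>u n + v n\<bar> \<le> W + 2 * \<gamma> / \<gamma>b * (2 / \<gamma>b) * q"
        using zero_le_power2[of "u n"] zero_le_power2[of "v n"] by linarith
      have tp: "\<bar>\<tau> * p n\<bar> \<le> \<bar>\<tau>\<bar>"
        using mult_left_mono[OF elim(2), of "\<bar>\<tau>\<bar>"] by (simp add: abs_mult)
      have 1: "\<bar>- (1 + \<gamma>\<^sup>2) * (Tp - Tm + (4 * j n + 2 * \<tau> * p n) / \<gamma>b)\<bar> \<le>
          (1 + \<gamma>\<^sup>2) * (\<bar>Tp - Tm\<bar> + 2 * \<bar>\<tau>\<bar> / \<gamma>b) + (1 + \<gamma>\<^sup>2) * (4 / \<gamma>b) * q"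
      proof -
        have "\<bar>(4 * j n + 2 * \<tau> * p n) / \<gamma>b\<bar> \<le> (4 * q + 2 * \<bar>\<tau>\<bar>) / \<gamma>b"
        proof -
          have "\<bar>4 * j n + 2 * \<tau> * p n\<bar> \<le> 4 * q + 2 * \<bar>\<tau>\<bar>" using tp unfolding q_def by linarith
          thus ?thesis using \<gamma>b by (simp add: divide_right_mono)
        qed
        hence "\<bar>Tp - Tm + (4 * j n + 2 * \<tau> * p n) / \<gamma>b\<bar> \<le> \<bar>Tp - Tm\<bar> + 2 * \<bar>\<tau>\<bar> / \<gamma>b + 4 / \<gamma>b * q"
          unfolding add_divide_distrib by (simp add: abs_le_iff) linarith
        hence "(1 + \<gamma>\<^sup>2) * \<bar>Tp - Tm + (4 * j n + 2 * \<tau> * p n) / \<gamma>b\<bar> \<le>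
            (1 + \<gamma>\<^sup>2) * (\<bar>Tp - Tm\<bar> + 2 * \<bar>\<tau>\<bar> / \<gamma>b + 4 / \<gamma>b * q)"
          by (rule mult_left_mono) simp
        moreover have "\<bar>1 + \<gamma>\<^sup>2\<bar> = 1 + \<gamma>\<^sup>2" by (rule abs_of_nonneg) simp
        hence "\<bar>- (1 + \<gamma>\<^sup>2) * X\<bar> = (1 + \<gamma>\<^sup>2) * \<bar>X\<bar>" for X
          by (simp only: abs_mult abs_minus_cancel)
        ultimately show ?thesis by (simp only: distrib_left[of _ _ "_ * q"] mult.assoc)
      qed
      have 2: "\<bar>\<tau> * (\<tau> - (\<gamma> + \<gamma>b) / 2 * p n)\<bar> \<le> \<bar>\<tau>\<bar> * (\<bar>\<tau>\<bar> + (\<gamma> + \<gamma>b) / 2)"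
      proof -
        have "\<bar>(\<gamma> + \<gamma>b) / 2 * p n\<bar> \<le> (\<gamma> + \<gamma>b) / 2"
          using mult_left_mono[OF elim(2), of "(\<gamma> + \<gamma>b) / 2"] \<gamma> \<gamma>b by (simp add: abs_mult)
        hence "\<bar>\<tau> - (\<gamma> + \<gamma>b) / 2 * p n\<bar> \<le> \<bar>\<tau>\<bar> + (\<gamma> + \<gamma>b) / 2" by linarith
        from mult_left_mono[OF this, of "\<bar>\<tau>\<bar>"] show ?thesis by (simp add: abs_mult)
      qed
      have 3: "\<bar>(\<gamma> - \<gamma>b) / 2 * (u n + v n + \<tau> * p n)\<bar> \<le>
          \<bar>\<gamma> - \<gamma>b\<bar> / 2 * (W + \<bar>\<tau>\<bar>) + \<bar>\<gamma> - \<gamma>b\<bar> / 2 * (2 * \<gamma> / \<gamma>b * (2 / \<gamma>b)) * q"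
      proof -
        have "\<bar>u n + v n + \<tau> * p n\<bar> \<le> (W + \<bar>\<tau>\<bar>) + 2 * \<gamma> / \<gamma>b * (2 / \<gamma>b) * q"
          using uv1 tp by linarith
        hence "\<bar>\<gamma> - \<gamma>b\<bar> / 2 * \<bar>u n + v n + \<tau> * p n\<bar> \<le>
            \<bar>\<gamma> - \<gamma>b\<bar> / 2 * ((W + \<bar>\<tau>\<bar>) + 2 * \<gamma> / \<gamma>b * (2 / \<gamma>b) * q)"
          by (rule mult_left_mono) simp
        moreover have "\<bar>(\<gamma> - \<gamma>b) / 2 * X\<bar> = \<bar>\<gamma> - \<gamma>b\<bar> / 2 * \<bar>X\<bar>" for X
          by (simp only: abs_mult abs_divide abs_numeral)
        ultimately show ?thesis by (simp only: distrib_left[of _ "W + _"] mult.assoc)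
      qed
      from 1 2 3 show ?case
        unfolding ident[OF elim(1)] q_def[symmetric] distrib_right by linarith
    qed
  qed (use \<gamma> in simp)
  have c0: "c \<longlonglongrightarrow> Tm"
  proof (rule Lim_transform_eventually)
    have "(\<lambda>n. Tm - 2 * j n / \<gamma>b - (p n)\<^sup>2) \<longlonglongrightarrow> Tm - 2 * 0 / \<gamma>b - 0\<^sup>2"
      using \<gamma>b by (intro tendsto_intros j0 p0) auto
    thus "(\<lambda>n. Tm - 2 * j n / \<gamma>b - (p n)\<^sup>2) \<longlonglongrightarrow> Tm" by simp
  qed (use ge1 in eventually_elim, simp add: c)
  have d0: "d \<longlonglongrightarrow> Tp"
  proof (rule Lim_transform_eventually)
    have "(\<lambda>n. Tp + 2 * (j n + \<tau> * p n) / \<gamma>b - (p n)\<^sup>2) \<longlonglongrightarrow> Tp + 2 * (0 + \<tau> * 0) / \<gamma>b - 0\<^sup>2"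
      using \<gamma>b by (intro tendsto_intros j0 p0) auto
    thus "(\<lambda>n. Tp + 2 * (j n + \<tau> * p n) / \<gamma>b - (p n)\<^sup>2) \<longlonglongrightarrow> Tp" by simp
  qed (use ge1 in eventually_elim, simp add: d)
  \<comment> \<open>The same upper bound is used a second time: now that \<open>c\<close> and
    \<open>d\<close> tend to the temperatures, it tends to 0 and forces \<open>u\<close> and
    \<open>v\<close> to vanish in the limit.\<close>
  define b where "b = (\<lambda>n. c n * (Tm - c n) + d n * (Tp - d n)
        + 2 * \<gamma> / \<gamma>b * (real n * (p n)\<^sup>2 * \<bar>c n\<bar> + real n * (real n * (p n)\<^sup>2)\<^sup>2))"
  have "b \<longlonglongrightarrow> Tm * (Tm - Tm) + Tp * (Tp - Tp) + 2 * \<gamma> / \<gamma>b * (0 * \<bar>Tm\<bar> + 0)"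
    unfolding b_def by (intro tendsto_add tendsto_mult tendsto_diff tendsto_rabs tendsto_const c0 d0 a0 b0)
  hence b: "b \<longlonglongrightarrow> 0" by simp
  have "(\<lambda>n. (u n)\<^sup>2) \<longlonglongrightarrow> 0"
    by (rule Lim_null_comparison[OF _ b], use ge1 in eventually_elim)
       (use uv_le in \<open>fastforce simp: b_def intro: order_trans[rotated]\<close>)
  moreover have "(\<lambda>n. (v n)\<^sup>2) \<longlonglongrightarrow> 0"
    by (rule Lim_null_comparison[OF _ b], use ge1 in eventually_elim)
       (use uv_le in \<open>fastforce simp: b_def intro: order_trans[rotated]\<close>)
  ultimately have u0: "u \<longlonglongrightarrow> 0" and v0: "v \<longlonglongrightarrow> 0"
    by (auto dest!: tendsto_real_sqrt simp: tendsto_rabs_zero_iff)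
  \<comment> \<open>Each occurrence of \<open>\<gamma>b\<close> is multiplied by a quantity that
    tends to 0, hence the limit does not depend on the thermostat coupling.\<close>
  have "(\<lambda>n. (- (1 + \<gamma>\<^sup>2) * (Tp - Tm + (4 * j n + 2 * \<tau> * p n) / \<gamma>b)
        - \<tau> * (\<tau> - (\<gamma> + \<gamma>b) / 2 * p n) - (\<gamma> - \<gamma>b) / 2 * (u n + v n + \<tau> * p n)) / (2 * \<gamma>))
     \<longlonglongrightarrow> (- (1 + \<gamma>\<^sup>2) * (Tp - Tm + (4 * 0 + 2 * \<tau> * 0) / \<gamma>b)
        - \<tau> * (\<tau> - (\<gamma> + \<gamma>b) / 2 * 0) - (\<gamma> - \<gamma>b) / 2 * (0 + 0 + \<tau> * 0)) / (2 * \<gamma>)"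
    using \<gamma> \<gamma>b by (intro tendsto_intros j0 p0 u0 v0) auto
  also have "(- (1 + \<gamma>\<^sup>2) * (Tp - Tm + (4 * 0 + 2 * \<tau> * 0) / \<gamma>b)
        - \<tau> * (\<tau> - (\<gamma> + \<gamma>b) / 2 * 0) - (\<gamma> - \<gamma>b) / 2 * (0 + 0 + \<tau> * 0)) / (2 * \<gamma>) =
      - (1 / 2) * (1 / \<gamma> + \<gamma>) * (Tp - Tm) - \<tau>\<^sup>2 / (2 * \<gamma>)"
    using \<gamma> by (simp add: field_simps power2_eq_square)
  finally show ?thesis
  proof (rule Lim_transform_eventually)
    show "\<forall>\<^sub>F n in sequentially. (- (1 + \<gamma>\<^sup>2) * (Tp - Tm + (4 * j n + 2 * \<tau> * p n) / \<gamma>b)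
        - \<tau> * (\<tau> - (\<gamma> + \<gamma>b) / 2 * p n) - (\<gamma> - \<gamma>b) / 2 * (u n + v n + \<tau> * p n)) / (2 * \<gamma>) = real n * j n"
      using ge1
    proof eventually_elim
      case (elim n)
      show ?case unfolding ident[OF elim, symmetric] using \<gamma> by simp
    qed
  qed
qed

theorem theorem3p2:
  fixes \<gamma> \<gamma>b Tm Tp \<tau> :: real
    and K :: "nat \<Rightarrow> real \<Rightarrow> config \<Rightarrow> config measure"
    and \<mu> :: "nat \<Rightarrow> config measure"
  assumes "\<gamma> > 0" and "\<gamma>b > 0" and "Tm > 0" and "Tp > 0"
    and "\<And>n. n \<ge> 1 \<Longrightarrow> markov_semigroup (Omega n) (K n)"
    and "\<And>n. n \<ge> 1 \<Longrightarrow> has_generator n (K n) (generator \<gamma> \<gamma>b Tm Tp \<tau> n)"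
    and "\<And>n. n \<ge> 1 \<Longrightarrow> stationary (Omega n) (K n) (\<mu> n)"
    and "\<And>n i. n \<ge> 1 \<Longrightarrow> i \<in> coords n \<Longrightarrow> integrable (\<mu> n) (\<lambda>\<xi>. (\<xi> i)\<^sup>2)"
  shows "(\<lambda>n. real n * stationary_current \<gamma> \<gamma>b Tm Tp \<tau> n (\<mu> n))
    \<longlonglongrightarrow> - (1 / 2) * (1 / \<gamma> + \<gamma>) * (Tp - Tm) - \<tau>\<^sup>2 / (2 * \<gamma>)"
proof -
  define j where "j = (\<lambda>n. stationary_current \<gamma> \<gamma>b Tm Tp \<tau> n (\<mu> n))"
  \<comment> \<open>The condition \<open>n \<ge> 1\<close> stands inside the existential quantifiers
    so that the choice of sequences ranges over all \<open>n\<close>.\<close>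
  have "\<forall>n. \<exists>p u v c d. n \<ge> 1 \<longrightarrow> (real n * \<gamma> + \<gamma>b) * p = \<tau>
    \<and> c = Tm - 2 * j n / \<gamma>b - p\<^sup>2 \<and> d = Tp + 2 * (j n + \<tau> * p) / \<gamma>b - p\<^sup>2
    \<and> \<gamma>b * (u\<^sup>2 + v\<^sup>2) \<le> \<gamma>b * (c * (Tm - c) + d * (Tp - d))
        + 2 * \<gamma> * (real n * p\<^sup>2 * \<bar>c\<bar> + real n * (real n * p\<^sup>2)\<^sup>2)
    \<and> 2 * \<gamma> * (real n * j n) = - (1 + \<gamma>\<^sup>2) * (Tp - Tm + (4 * j n + 2 * \<tau> * p) / \<gamma>b)
        - \<tau> * (\<tau> - (\<gamma> + \<gamma>b) / 2 * p) - (\<gamma> - \<gamma>b) / 2 * (u + v + \<tau> * p)"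
  proof
    fix n
    show "\<exists>p u v c d. n \<ge> 1 \<longrightarrow> (real n * \<gamma> + \<gamma>b) * p = \<tau>
    \<and> c = Tm - 2 * j n / \<gamma>b - p\<^sup>2 \<and> d = Tp + 2 * (j n + \<tau> * p) / \<gamma>b - p\<^sup>2
    \<and> \<gamma>b * (u\<^sup>2 + v\<^sup>2) \<le> \<gamma>b * (c * (Tm - c) + d * (Tp - d))
        + 2 * \<gamma> * (real n * p\<^sup>2 * \<bar>c\<bar> + real n * (real n * p\<^sup>2)\<^sup>2)
    \<and> 2 * \<gamma> * (real n * j n) = - (1 + \<gamma>\<^sup>2) * (Tp - Tm + (4 * j n + 2 * \<tau> * p) / \<gamma>b)
        - \<tau> * (\<tau> - (\<gamma> + \<gamma>b) / 2 * p) - (\<gamma> - \<gamma>b) / 2 * (u + v + \<tau> * p)"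
    proof (cases "n \<ge> 1")
      case True
      show ?thesis
        using stationary_current_characterization[OF assms(1,2) True assms(5)[OF True] assms(6)[OF True]
            assms(7)[OF True] assms(8)[OF True]]
        unfolding j_def by fast
    qed simp
  qed
  then obtain p u v c d where *: "\<And>n. n \<ge> 1 \<Longrightarrow> (real n * \<gamma> + \<gamma>b) * p n = \<tau>
    \<and> c n = Tm - 2 * j n / \<gamma>b - (p n)\<^sup>2 \<and> d n = Tp + 2 * (j n + \<tau> * p n) / \<gamma>b - (p n)\<^sup>2
    \<and> \<gamma>b * ((u n)\<^sup>2 + (v n)\<^sup>2) \<le> \<gamma>b * (c n * (Tm - c n) + d n * (Tp - d n))
        + 2 * \<gamma> * (real n * (p n)\<^sup>2 * \<bar>c n\<bar> + real n * (real n * (p n)\<^sup>2)\<^sup>2)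
    \<and> 2 * \<gamma> * (real n * j n) = - (1 + \<gamma>\<^sup>2) * (Tp - Tm + (4 * j n + 2 * \<tau> * p n) / \<gamma>b)
        - \<tau> * (\<tau> - (\<gamma> + \<gamma>b) / 2 * p n) - (\<gamma> - \<gamma>b) / 2 * (u n + v n + \<tau> * p n)"
    unfolding choice_iff by blast
  show ?thesis
    unfolding j_def[symmetric, THEN fun_cong]
    by (rule current_limit[OF assms(1,2), of p \<tau> c Tm j d Tp u v]) (use * in blast)+
qed

end
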